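(* Let $0<a<b<\infty$, and let $\psi\in C([a,b],\mathbb{R})$ be increasing with $\psi'(t)\neq0$ for all $t\in[a,b]$. Let $f:[a,b]\times\mathbb{R}\times\mathbb{R}\to\mathbb{R}$ be continuous and satisfy, with constants $M>0$ and $M^*<1$, the Lipschitz condition on $\mathbb{R}$ $$\|f(t,u_1,v_1)-f(t,u_2,v_2)\|_{C_{1-\gamma;\psi}[a,b]}\le M\|u_1-u_2\|_{C_{1-\gamma;\psi}[a,b]}+M^*\|v_1-v_2\|_{C_{1-\gamma;\psi}[a,b]}$$ for all $t\in(a,b]$ and all $u_i,v_i\in\mathbb{R}$ $(i=1,2)$. Let $\alpha>0$, $\epsilon>0$ be such that $0<\alpha-\epsilon<\alpha\le1$, let $0\le\beta\le1$, $\gamma=\alpha+\beta-\alpha\beta$, and let $u_a,u_a^*\in\mathbb{R}$. For any $a\le t\le b$, assume that $u$ is the solution of $$D_{a^+}^{\alpha,\beta;\psi}u(t)=f\big(t,u(t),D_{a^+}^{\alpha,\beta;\psi}u(t)\big),\quad 0<\alpha<1,\ 0\le\beta\le1,\ t>a,\qquad I_{a^+}^{1-\gamma;\psi}u(a)=u_a,$$ and $u^*$ is the solution of $$D_{a^+}^{\alpha-\epsilon,\beta;\psi}u^*(t)=f\big(t,u^*(t),D_{a^+}^{\alpha-\epsilon,\beta;\psi}u^*(t)\big),\quad 0<\alpha<1,\ 0\le\beta\le1,\ t>a,\qquad I_{a^+}^{1-\gamma-\epsilon(\beta-1);\psi}u^*(a)=u_a^*.$$ Then, for $a<t\le b$,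 $$|u^*(t)-u(t)|\le A(t)+\int_a^t\left[\sum_{k=1}^\infty\left(\frac{M\,\Gamma(\alpha-\epsilon)}{\Gamma(\alpha)(1-M^* )}\right)^k\frac{\psi'(s)(\psi(t)-\psi(s))^{k(\alpha-\epsilon)-1}}{\Gamma(k(\alpha-\epsilon))}A(s)\right]ds,$$ where $$A(t)=\left|\frac{u_a^*(\psi(t)-\psi(a))^{\gamma+\epsilon(\beta-1)-1}}{\Gamma(\gamma+\epsilon(\beta-1))}-\frac{u_a(\psi(t)-\psi(a))^{\gamma-1}}{\Gamma(\gamma)}\right|+\|f\|\left|\frac{(\psi(t)-\psi(a))^{\alpha-\epsilon}}{\Gamma(\alpha-\epsilon+1)}-\frac{(\psi(t)-\psi(a))^{\alpha-\epsilon}}{\Gamma(\alpha-\epsilon)\Gamma(\alpha)}\right|+\|f\|\left|\frac{(\psi(t)-\psi(a))^{\alpha-\epsilon}}{\Gamma(\alpha-\epsilon)\Gamma(\alpha)}-\frac{(\psi(t)-\psi(a))^{\alpha}}{\Gamma(\alpha+1)}\right|,$$ with $\|f\|=\max_{t\in[a,b]}|f(t,u(t),F_u(t))|$ and $F_u(t)=D_{a^+}^{\alpha,\beta;\psi}u(t)$.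
   Context: For $\mu>0$, the $\psi$-Riemann–Liouville fractional integral is $$I_{a^+}^{\mu;\psi}h(t)=\frac{1}{\Gamma(\mu)}\int_a^t\psi'(s)(\psi(t)-\psi(s))^{\mu-1}h(s)\,ds,$$ and $I_{a^+}^{0;\psi}$ is the identity. The value $I_{a^+}^{\mu;\psi}h(a)$ means $\lim_{t\to a^+}I_{a^+}^{\mu;\psi}h(t)$. For $0<\alpha<1$, $0\le\beta\le1$, the $\psi$-Hilfer fractional derivative of order $\alpha$ and type $\beta$ is $$D_{a^+}^{\alpha,\beta;\psi}h(t)=I_{a^+}^{\beta(1-\alpha);\psi}\Big[\tfrac{1}{\psi'(t)}\tfrac{d}{dt}\Big]I_{a^+}^{(1-\beta)(1-\alpha);\psi}h(t).$$ With $\gamma=\alpha+\beta-\alpha\beta$ one has $(1-\beta)(1-\alpha)=1-\gamma$; replacing $\alpha$ by $\alpha-\epsilon$ replaces $\gamma$ by $\gamma+\epsilon(\beta-1)$. Weighted space: $C_{1-\gamma;\psi}[a,b]=\{h:(a,b]\to\mathbb{R}\;:\;(\psi(t)-\psi(a))^{1-\gamma}h(t)\in C[a,b]\}$ (meaning that the weighted function extends continuously to $[a,b]$), with norm $\|h\|_{C_{1-\gamma;\psi}[a,b]}=\max_{t\in[a,b]}|(\psi(t)-\psi(a))^{1-\gamma}h(t)|$. *)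

theory Defs
  imports "HOL-Analysis.Analysis"
begin

text \<open>
  Derivative of a function that only matters on \<open>[a,b]\<close>: two-sided at interior points and
  one-sided at the end points.
\<close>
definition deriv_on :: "real \<Rightarrow> real \<Rightarrow> (real \<Rightarrow> real) \<Rightarrow> real \<Rightarrow> real" where
  "deriv_on a b h t = vector_derivative h (at t within {a..b})"

definition psi_kernel_fun ::
    "real \<Rightarrow> real \<Rightarrow> (real \<Rightarrow> real) \<Rightarrow> real \<Rightarrow> (real \<Rightarrow> real) \<Rightarrow> real \<Rightarrow> real \<Rightarrow> real" where
  "psi_kernel_fun a b \<psi> \<mu> h t s = deriv_on a b \<psi> s * (\<psi> t - \<psi> s) powr (\<mu> - 1) * h s"

definition psi_int ::
    "real \<Rightarrow> real \<Rightarrow> (real \<Rightarrow> real) \<Rightarrow> real \<Rightarrow> (real \<Rightarrow> real) \<Rightarrow> real \<Rightarrow> real" where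
  "psi_int a b \<psi> \<mu> h t =
     (if \<mu> = 0 then h t
      else 1 / Gamma \<mu> * (LBINT s:{a..t}. psi_kernel_fun a b \<psi> \<mu> h t s))"

text \<open>
  The Lebesgue integral of a non-integrable function is \<open>0\<close> by convention, so the existence of
  the fractional integral and of the fractional derivative is recorded separately.
\<close>
definition psi_int_exists ::
    "real \<Rightarrow> real \<Rightarrow> (real \<Rightarrow> real) \<Rightarrow> real \<Rightarrow> (real \<Rightarrow> real) \<Rightarrow> real \<Rightarrow> bool" where
  "psi_int_exists a b \<psi> \<mu> h t \<longleftrightarrow>
     \<mu> = 0 \<or> set_integrable lborel {a..t} (psi_kernel_fun a b \<psi> \<mu> h t)"

definition psi_deriv ::
    "real \<Rightarrow> real \<Rightarrow> (real \<Rightarrow> real) \<Rightarrow> (real \<Rightarrow> real) \<Rightarrow> real \<Rightarrow> real" where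
  "psi_deriv a b \<psi> h t = 1 / deriv_on a b \<psi> t * deriv_on a b h t"

definition psi_hilfer ::
    "real \<Rightarrow> real \<Rightarrow> (real \<Rightarrow> real) \<Rightarrow> real \<Rightarrow> real \<Rightarrow> (real \<Rightarrow> real) \<Rightarrow> real \<Rightarrow> real" where
  "psi_hilfer a b \<psi> \<alpha> \<beta> h =
     psi_int a b \<psi> (\<beta> * (1 - \<alpha>)) (psi_deriv a b \<psi> (psi_int a b \<psi> ((1 - \<beta>) * (1 - \<alpha>)) h))"

definition psi_hilfer_exists ::
    "real \<Rightarrow> real \<Rightarrow> (real \<Rightarrow> real) \<Rightarrow> real \<Rightarrow> real \<Rightarrow> (real \<Rightarrow> real) \<Rightarrow> real \<Rightarrow> bool" where
  "psi_hilfer_exists a b \<psi> \<alpha> \<beta> h t \<longleftrightarrow>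
     (\<forall>s\<in>{a<..t}. psi_int_exists a b \<psi> ((1 - \<beta>) * (1 - \<alpha>)) h s \<and>
        psi_int a b \<psi> ((1 - \<beta>) * (1 - \<alpha>)) h differentiable (at s within {a..b})) \<and>
     psi_int_exists a b \<psi> (\<beta> * (1 - \<alpha>))
       (psi_deriv a b \<psi> (psi_int a b \<psi> ((1 - \<beta>) * (1 - \<alpha>)) h)) t"

text \<open>
  The function \<open>(\<psi>(t) - \<psi>(a))\<^sup>r h(t)\<close>, for \<open>h\<close> given on \<open>(a,b]\<close>, with its limit as value at \<open>a\<close>;
  the value \<open>h a\<close> plays no role.  In the weighted space of order \<open>1 - \<gamma>\<close> one takes \<open>r = 1 - \<gamma>\<close>.
\<close>
definition psi_weighted ::
    "real \<Rightarrow> (real \<Rightarrow> real) \<Rightarrow> real \<Rightarrow> (real \<Rightarrow> real) \<Rightarrow> real \<Rightarrow> real" where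
  "psi_weighted a \<psi> r h t =
     (if t = a then Lim (at_right a) (\<lambda>s. (\<psi> s - \<psi> a) powr r * h s)
      else (\<psi> t - \<psi> a) powr r * h t)"

definition C_weighted :: "real \<Rightarrow> real \<Rightarrow> (real \<Rightarrow> real) \<Rightarrow> real \<Rightarrow> (real \<Rightarrow> real) set" where
  "C_weighted a b \<psi> r = {h. continuous_on {a..b} (psi_weighted a \<psi> r h)}"

text \<open>On \<open>C_weighted\<close> the supremum is attained.\<close>
definition norm_weighted ::
    "real \<Rightarrow> real \<Rightarrow> (real \<Rightarrow> real) \<Rightarrow> real \<Rightarrow> (real \<Rightarrow> real) \<Rightarrow> real" where
  "norm_weighted a b \<psi> r h = (SUP t\<in>{a..b}. \<bar>psi_weighted a \<psi> r h t\<bar>)"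

text \<open>
  \<open>u\<close> solves \<open>D u(t) = f(t, u(t), D u(t))\<close> on \<open>(a,b]\<close>, where \<open>D\<close> has order \<open>\<alpha>\<close> and type \<open>\<beta>\<close>,
  with initial value \<open>c\<close> for the fractional integral of order \<open>1 - \<gamma>\<close>.
  Solutions are sought in the weighted space.
\<close>
definition psi_hilfer_solution ::
    "real \<Rightarrow> real \<Rightarrow> (real \<Rightarrow> real) \<Rightarrow> (real \<Rightarrow> real \<Rightarrow> real \<Rightarrow> real) \<Rightarrow>
     real \<Rightarrow> real \<Rightarrow> real \<Rightarrow> real \<Rightarrow> (real \<Rightarrow> real) \<Rightarrow> bool" where
  "psi_hilfer_solution a b \<psi> f \<alpha> \<beta> \<gamma> c u \<longleftrightarrow>
     u \<in> C_weighted a b \<psi> (1 - \<gamma>) \<and>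
     (\<forall>t\<in>{a<..b}. psi_hilfer_exists a b \<psi> \<alpha> \<beta> u t \<and>
        psi_hilfer a b \<psi> \<alpha> \<beta> u t = f t (u t) (psi_hilfer a b \<psi> \<alpha> \<beta> u t)) \<and>
     (psi_int a b \<psi> (1 - \<gamma>) u \<longlongrightarrow> c) (at_right a)"

end

theory Submission
  imports Defs
begin

text \<open>
  Put \<open>\<nu> = \<alpha> - \<epsilon>\<close> and \<open>\<gamma>' = \<gamma> + \<epsilon>(\<beta> - 1)\<close>.  The substitution \<open>x = \<psi>(t) - \<psi>(a)\<close> turns the
  \<open>\<psi>\<close>-fractional integrals into Riemann--Liouville integrals \<open>I\<^sup>\<mu>\<close> on \<open>(0,x)\<close>.  Since
  \<open>I\<^sup>1\<^sup>-\<^sup>\<gamma> u = c + I\<^sup>1 g\<close> and the Hilfer derivative of \<open>u\<close> is \<open>F = I\<^sup>\<gamma>\<^sup>-\<^sup>\<alpha> g\<close>, applying \<open>I\<^sup>\<gamma>\<close> and the semigroup law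
  gives \<open>I\<^sup>1 u = I\<^sup>1 (c x\<^sup>\<gamma>\<^sup>-\<^sup>1 / \<Gamma>(\<gamma>) + I\<^sup>\<alpha> F)\<close>; both integrands are continuous, so they agree.

  Subtracting the two Volterra equations,
  \<open>u\<^sup>* - u\<close> is the difference of the initial terms plus \<open>I\<^sup>\<nu>(F\<^sup>* - F) + (I\<^sup>\<nu> F - I\<^sup>\<alpha> F)\<close>.  The Lipschitz
  condition gives \<open>|F\<^sup>* - F| \<le> M/(1 - M\<^sup>*) |u\<^sup>* - u|\<close>, and \<open>M/(1 - M\<^sup>*)\<close> is at most the constant of the
  theorem because \<open>\<Gamma>\<close> decreases on \<open>(0,1]\<close>.  Iterating the resulting inequality \<open>D \<le> A + c I\<^sup>\<nu> D\<close> yields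
  the series; the remainder \<open>c\<^sup>n I\<^sup>n\<^sup>\<nu> D\<close> vanishes because \<open>\<Gamma>\<close> grows faster than geometrically.
\<close>

section \<open>Riemann--Liouville fractional integrals\<close>

text \<open>The substitution z = r + (x - r) t reduces both claims to the Beta integral on the unit
  interval; nonnegativity of its integrand turns the gauge integral into a Lebesgue integral. This
  is the inner integral of the Fubini argument for the semigroup law and, with r = 0, the power
  rule.\<close>

lemma beta_kernel:
  fixes p q r x :: real
  assumes "0 < p" "0 < q" "r < x"
  shows "set_integrable lborel {r<..<x} (\<lambda>z. (x - z) powr (p - 1) * (z - r) powr (q - 1))"
    and "(LBINT z:{r<..<x}. (x - z) powr (p - 1) * (z - r) powr (q - 1)) = Beta p q * (x - r) powr (p + q - 1)"
proof -
  let ?h = "\<lambda>t::real. t powr (q - 1) * (1 - t) powr (p - 1)"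
  let ?g = "\<lambda>z::real. indicator {r<..<x} z *\<^sub>R ((x - z) powr (p - 1) * (z - r) powr (q - 1))"
  have hi: "(?h has_integral Beta q p) {0<..<1}"
    using has_integral_Beta_real[of q p] assms by (simp add: has_integral_Icc_iff_Ioo)
  then have abs: "?h absolutely_integrable_on {0<..<1}"
    by (intro nonnegative_absolutely_integrable_1) (auto simp: has_integral_iff)
  have hm: "(\<lambda>t. indicator {0<..<1::real} t *\<^sub>R ?h t) \<in> borel_measurable lborel"
    by measurable
  have int01: "set_integrable lborel {0<..<1} ?h"
    using abs integrable_completion[OF hm] unfolding set_integrable_def by simp
  have val01: "(LBINT t:{0<..<1}. ?h t) = Beta q p"
    using set_borel_integral_eq_integral(2)[OF int01] hi by (simp add: has_integral_iff)
  have eq: "?g (r + (x - r) * t) = (x - r) powr (p + q - 2) * (indicator {0<..<1} t *\<^sub>R ?h t)" for t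
  proof (cases "t \<in> {0<..<1}")
    case True
    have "(x - r) powr (p + q - 2) = (x - r) powr (p - 1) * (x - r) powr (q - 1)"
      by (simp flip: powr_add)
    moreover have "x - (r + (x - r) * t) = (x - r) * (1 - t)" "r + (x - r) * t - r = (x - r) * t"
      by (auto simp: algebra_simps)
    moreover have "r + (x - r) * t < x"
      using \<open>x - (r + (x - r) * t) = _\<close> True assms by (smt (verit) greaterThanLessThan_iff mult_pos_pos)
    moreover have "r < r + (x - r) * t" using True assms by simp
    ultimately show ?thesis
      using True assms by (simp add: powr_mult)
  next
    case False
    have "r + (x - r) * t \<notin> {r<..<x}"
    proof
      assume "r + (x - r) * t \<in> {r<..<x}"
      then have "0 < (x - r) * t" "0 < (x - r) * (1 - t)" by (auto simp: algebra_simps)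
      with False assms show False by (auto simp: zero_less_mult_iff)
    qed
    then show ?thesis using False by simp
  qed
  have "integrable lborel (\<lambda>t. ?g (r + (x - r) * t))"
    unfolding eq using int01 unfolding set_integrable_def by simp
  then show "set_integrable lborel {r<..<x} (\<lambda>z. (x - z) powr (p - 1) * (z - r) powr (q - 1))"
    using lborel_integrable_real_affine_iff[of "x - r" ?g r] assms unfolding set_integrable_def by simp
  have "(LBINT z:{r<..<x}. (x - z) powr (p - 1) * (z - r) powr (q - 1)) = (x - r) * ((x - r) powr (p + q - 2) * Beta q p)"
    unfolding set_lebesgue_integral_def
    using lborel_integral_real_affine[of "x - r" ?g r] assms val01
    unfolding eq set_lebesgue_integral_def by simp
  also have "\<dots> = Beta p q * (x - r) powr (p + q - 1)"
    using assms powr_mult_base[of "x - r" "p + q - 2"] by (simp add: Beta_commute)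
  finally show "(LBINT z:{r<..<x}. (x - z) powr (p - 1) * (z - r) powr (q - 1)) = Beta p q * (x - r) powr (p + q - 1)" .
qed

text \<open>
  Order \<open>0\<close> is the identity, as for \<^const>\<open>psi_int\<close>; the endpoints \<open>0\<close> and \<open>x\<close> are excluded, so the
  value of \<open>H\<close> at \<open>0\<close> never matters.
\<close>
definition rl :: "real \<Rightarrow> (real \<Rightarrow> real) \<Rightarrow> real \<Rightarrow> real" where
  "rl p H x = (if p = 0 then H x else (LBINT y:{0<..<x}. (x - y) powr (p - 1) * H y) / Gamma p)"

text \<open>A separate record of integrability, because a divergent Lebesgue integral has the value
  0. There is no clause for order 0 as in \<open>psi_int_exists\<close>, so that order is split off
  where existence matters.\<close>

abbreviation rl_exists :: "real \<Rightarrow> (real \<Rightarrow> real) \<Rightarrow> real \<Rightarrow> bool" where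
  "rl_exists p H x \<equiv> set_integrable lborel {0<..<x} (\<lambda>y. (x - y) powr (p - 1) * H y)"

text \<open>Fubini on the triangle 0 < y < z < x. Integrating in z first gives a Beta kernel, so the
  double integral collapses to the kernel of order p + q; the same computation with absolute values
  shows that existence at order p + q already gives integrability on the triangle.\<close>

lemma rl_semigroup:
  fixes p q x :: real
  assumes p: "0 < p" and q: "0 < q" and H[measurable]: "H \<in> borel_measurable borel"
    and int: "rl_exists (p + q) H x"
  shows "rl_exists p (rl q H) x" "rl p (rl q H) x = rl (p + q) H x"
proof -
  define k where "k = (\<lambda>(y, z). indicator {0<..<x} z * indicator {0<..<z} y
     * ((x - z) powr (p - 1) * (z - y) powr (q - 1) * H y) :: real)"
  have [measurable]: "k \<in> borel_measurable (lborel \<Otimes>\<^sub>M lborel)"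
  proof -
    have "(\<lambda>w. indicator {w. 0 < snd w \<and> snd w < x \<and> 0 < fst w \<and> fst w < snd w} w
     * ((x - snd w) powr (p - 1) * (snd w - fst w) powr (q - 1) * H (fst w)) :: real)
      \<in> borel_measurable (lborel \<Otimes>\<^sub>M lborel)"
      by measurable
    also have "(\<lambda>w. indicator {w. 0 < snd w \<and> snd w < x \<and> 0 < fst w \<and> fst w < snd w} w
     * ((x - snd w) powr (p - 1) * (snd w - fst w) powr (q - 1) * H (fst w)) :: real) = k"
      by (auto simp: k_def fun_eq_iff indicator_def)
    finally show ?thesis .
  qed
  have k_y: "k (y, z) = (indicator {0<..<x} y * H y) * (indicator {y<..<x} z *\<^sub>R ((x - z) powr (p - 1) * (z - y) powr (q - 1)))" for y z
    by (auto simp: k_def indicator_def)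
  have inner: "integrable lborel (\<lambda>z. k (y, z))" for y
  proof (cases "y \<in> {0<..<x}")
    case True
    then show ?thesis
      using beta_kernel(1)[OF p q, of y x] unfolding k_y set_integrable_def by simp
  next
    case False
    then show ?thesis by (simp add: k_y)
  qed
  have val: "(LBINT z. k (y, z)) = Beta p q * (indicator {0<..<x} y *\<^sub>R ((x - y) powr (p + q - 1) * H y))" for y
  proof (cases "y \<in> {0<..<x}")
    case True
    then show ?thesis
      using beta_kernel(2)[OF p q, of y x] unfolding k_y set_lebesgue_integral_def by simp
  next
    case False
    then show ?thesis by (simp add: k_y)
  qed
  have nval: "(LBINT z. norm (k (y, z))) = Beta p q * norm (indicator {0<..<x} y *\<^sub>R ((x - y) powr (p + q - 1) * H y))" for y
  proof (cases "y \<in> {0<..<x}")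
    case True
    then show ?thesis
      using beta_kernel(2)[OF p q, of y x] unfolding k_y set_lebesgue_integral_def
      by (simp add: abs_mult)
  next
    case False
    then show ?thesis by (simp add: k_y)
  qed
  have ik: "integrable (lborel \<Otimes>\<^sub>M lborel) k"
  proof (rule lborel_pair.Fubini_integrable)
    show "integrable lborel (\<lambda>y. LBINT z. norm (k (y, z)))"
      unfolding nval using int unfolding set_integrable_def by auto
  qed (auto intro: inner)
  \<comment> \<open>The factor \<open>Gamma q\<close> undoes the normalisation contained in
    \<open>rl q H z\<close>.\<close>
  have k_z: "(LBINT y. k (y, z)) = indicator {0<..<x} z *\<^sub>R ((x - z) powr (p - 1) * rl q H z) * Gamma q" for z
  proof -
    have "(LBINT y. k (y, z)) = (LBINT y. (indicator {0<..<x} z * (x - z) powr (p - 1)) * (indicator {0<..<z} y *\<^sub>R ((z - y) powr (q - 1) * H y)))"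
      by (simp add: k_def mult_ac)
    moreover have "Gamma q \<noteq> 0"
      using Gamma_real_pos[OF q] by linarith
    ultimately show ?thesis
      using q by (simp add: rl_def set_lebesgue_integral_def)
  qed
  have ik2: "integrable (lborel \<Otimes>\<^sub>M lborel) (\<lambda>(y, z). k (y, z))" using ik by simp
  have "integrable lborel (\<lambda>z. LBINT y. k (y, z))"
    using lborel_pair.integrable_snd[OF ik2] .
  then show "rl_exists p (rl q H) x"
    using less_imp_neq[OF Gamma_real_pos[OF q]] unfolding k_z set_integrable_def by simp
  have "(LBINT z. LBINT y. k (y, z)) = (LBINT y. LBINT z. k (y, z))"
    using lborel_pair.Fubini_integral[OF ik2] .
  then have "(LBINT z:{0<..<x}. (x - z) powr (p - 1) * rl q H z) * Gamma q
     = Beta p q * (LBINT y:{0<..<x}. (x - y) powr (p + q - 1) * H y)"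
    unfolding k_z val set_lebesgue_integral_def by simp
  moreover have "Gamma p \<noteq> 0" "Gamma q \<noteq> 0" "Gamma (p + q) \<noteq> 0"
    using p q Gamma_real_pos[of p] Gamma_real_pos[of q] Gamma_real_pos[of "p + q"] by linarith+
  ultimately show "rl p (rl q H) x = rl (p + q) H x"
    using p q by (simp add: rl_def[of p] rl_def[of "p+q"] Beta_def field_simps)
qed

section \<open>Linearity, monotonicity and existence criteria\<close>

lemma rl_zero [simp]: "rl 0 H = H"
  by (simp add: rl_def fun_eq_iff)

lemma rl_semigroup':
  assumes "0 \<le> p" "0 \<le> q" "H \<in> borel_measurable borel" "rl_exists (p + q) H x"
  shows "rl p (rl q H) x = rl (p + q) H x"
  using assms rl_semigroup(2)[of p q H x] by (cases "p = 0"; cases "q = 0") auto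

lemma rl_cong:
  assumes "0 < p" "\<And>y. y \<in> {0<..<x} \<Longrightarrow> H y = K y"
  shows "rl p H x = rl p K x"
  unfolding rl_def using assms by (auto intro!: set_lebesgue_integral_cong arg_cong2[where f="(/)"])

lemma rl_add:
  assumes "0 < p" "rl_exists p H x" "rl_exists p K x"
  shows "rl p (\<lambda>y. H y + K y) x = rl p H x + rl p K x"
  using assms set_integral_add(2)[OF assms(2,3)] by (simp add: rl_def distrib_left add_divide_distrib)

lemma rl_diff:
  assumes "0 < p" "rl_exists p H x" "rl_exists p K x"
  shows "rl p (\<lambda>y. H y - K y) x = rl p H x - rl p K x"
  using assms set_integral_diff(2)[OF assms(2,3)] by (simp add: rl_def right_diff_distrib diff_divide_distrib)

lemma rl_cmult: "rl p (\<lambda>y. c * H y) x = c * rl p H x"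
  unfolding rl_def by (simp add: mult.left_commute[of _ c])

lemma rl_exists_cmult:
  assumes "rl_exists p H x" shows "rl_exists p (\<lambda>y. c * H y) x"
  using assms set_integrable_mult_right[of c lborel "{0<..<x}" "\<lambda>y. (x - y) powr (p - 1) * H y"]
  by (simp add: mult_ac)

lemma rl_exists_add:
  assumes "rl_exists p H x" "rl_exists p K x" shows "rl_exists p (\<lambda>y. H y + K y) x"
  using set_integral_add(1)[OF assms] by (simp add: distrib_left)

lemma rl_exists_diff:
  assumes "rl_exists p H x" "rl_exists p K x" shows "rl_exists p (\<lambda>y. H y - K y) x"
  using set_integral_diff(1)[OF assms] by (simp add: right_diff_distrib)

lemma rl_mono:
  assumes "0 < p" "rl_exists p H x" "rl_exists p K x" "\<And>y. y \<in> {0<..<x} \<Longrightarrow> H y \<le> K y"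
  shows "rl p H x \<le> rl p K x"
  using assms Gamma_real_pos[of p]
  by (auto simp: rl_def intro!: divide_right_mono set_integral_mono mult_left_mono)

lemma rl_nonneg:
  assumes "0 < p" "\<And>y. y \<in> {0<..<x} \<Longrightarrow> 0 \<le> H y"
  shows "0 \<le> rl p H x"
proof -
  have "0 \<le> (LBINT y:{0<..<x}. (x - y) powr (p - 1) * H y)"
    unfolding set_lebesgue_integral_def using assms
    by (intro integral_nonneg_AE) (auto simp: indicator_def)
  then show ?thesis using assms Gamma_real_pos[of p] by (simp add: rl_def)
qed

lemma rl_exists_powr:
  assumes "0 < p" "0 < d"
  shows "rl_exists p (\<lambda>y. y powr (d - 1)) x"
  using beta_kernel(1)[OF assms, of 0 x] by (cases "0 < x") auto

lemma rl_powr: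
  assumes "0 < p" "0 < d" "0 < x"
  shows "rl p (\<lambda>y. y powr (d - 1)) x = Gamma d / Gamma (p + d) * x powr (p + d - 1)"
  using beta_kernel(2)[OF assms] assms less_imp_neq[OF Gamma_real_pos[OF assms(1)]]
  by (simp add: rl_def Beta_def)

lemma rl_exists_dominated:
  assumes "rl_exists p K x" and [measurable]: "H \<in> borel_measurable borel"
    and "\<And>y. y \<in> {0<..<x} \<Longrightarrow> \<bar>H y\<bar> \<le> K y"
  shows "rl_exists p H x"
  using assms(1)
proof (rule set_integrable_bound)
  show "set_borel_measurable lborel {0<..<x} (\<lambda>y. (x - y) powr (p - 1) * H y)"
    unfolding set_borel_measurable_def by measurable
  show "AE y in lborel. y \<in> {0<..<x} \<longrightarrow> norm ((x - y) powr (p - 1) * H y) \<le> norm ((x - y) powr (p - 1) * K y)"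
    using assms(3) by (intro AE_I2) (fastforce simp: abs_mult intro!: mult_left_mono)
qed

lemma rl_exists_powr_bounded:
  assumes "0 < p" "0 < d" "H \<in> borel_measurable borel"
    and "\<And>y. y \<in> {0<..<x} \<Longrightarrow> \<bar>H y\<bar> \<le> C * y powr (d - 1)"
  shows "rl_exists p H x"
  by (rule rl_exists_dominated[OF rl_exists_cmult[OF rl_exists_powr[OF assms(1,2)]] assms(3,4)])

text \<open>For exponents p - 1 that are nonnegative the kernel is bounded by its value at y = 0, so
  integrability of H suffices.\<close>

lemma rl_exists_ge_1:
  assumes "1 \<le> p" and [measurable]: "H \<in> borel_measurable borel" and "set_integrable lborel {0<..<x} H"
  shows "rl_exists p H x"
proof (rule set_integrable_bound)
  show "set_integrable lborel {0<..<x} (\<lambda>y. x powr (p - 1) * H y)"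
    using assms(3) by simp
  show "set_borel_measurable lborel {0<..<x} (\<lambda>y. (x - y) powr (p - 1) * H y)"
    unfolding set_borel_measurable_def by measurable
  show "AE y in lborel. y \<in> {0<..<x} \<longrightarrow> norm ((x - y) powr (p - 1) * H y) \<le> norm (x powr (p - 1) * H y)"
    using assms(1) by (intro AE_I2) (auto simp: abs_mult intro!: mult_right_mono powr_mono2)
qed

section \<open>Order one and continuity in the upper limit\<close>

lemma rl_1:
  "rl 1 H x = (LBINT y:{0<..<x}. H y)"
  unfolding rl_def by (auto intro!: set_lebesgue_integral_cong)

lemma rl_exists_1: "rl_exists 1 H x \<longleftrightarrow> set_integrable lborel {0<..<x} H"
  by (intro set_integrable_cong) auto

text \<open>Rescaling to the unit interval moves x from the domain and the singular kernel into the
  argument of H, which prepares dominated convergence in x.\<close>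

lemma rl_scaled:
  assumes "0 < p" "0 < x"
  shows "rl p H x = x powr p / Gamma p * (LBINT z:{0<..<1}. (1 - z) powr (p - 1) * H (x * z))"
proof -
  let ?g = "\<lambda>y. indicator {0<..<x} y *\<^sub>R ((x - y) powr (p - 1) * H y)"
  have eq: "?g (0 + x * z) = x powr (p - 1) * (indicator {0<..<1} z *\<^sub>R ((1 - z) powr (p - 1) * H (x * z)))" for z
  proof (cases "z \<in> {0<..<1}")
    case True
    moreover have "x - x * z = x * (1 - z)" by (simp add: algebra_simps)
    ultimately show ?thesis using assms by (simp add: powr_mult)
  next
    case False
    then have "x * z \<notin> {0<..<x}" using assms by (auto simp: zero_less_mult_iff)
    then show ?thesis using False by simp
  qed
  show ?thesis
    using lborel_integral_real_affine[of x ?g 0] assms powr_mult_base[of x "p - 1"]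
    unfolding eq by (simp add: rl_def set_lebesgue_integral_def)
qed

text \<open>Dominated convergence in the rescaled integral: the growth bound on H makes a constant
  multiple of the Beta kernel a dominating function along any convergent sequence.\<close>

lemma continuous_on_rl:
  assumes p: "0 < p" and d: "0 < d" and [measurable]: "H \<in> borel_measurable borel"
    and cont: "continuous_on {0<..L} H"
    and bound: "\<And>y. y \<in> {0<..L} \<Longrightarrow> \<bar>H y\<bar> \<le> C * y powr (d - 1)"
  shows "continuous_on {0<..L} (rl p H)"
proof -
  have "continuous_on {0<..L} (\<lambda>x. LBINT z:{0<..<1}. (1 - z) powr (p - 1) * H (x * z))"
    unfolding continuous_on_sequentially o_def
  proof (intro allI ballI impI)
    fix X :: "nat \<Rightarrow> real" and a
    assume a: "a \<in> {0<..L}" and X: "(\<forall>n. X n \<in> {0<..L}) \<and> X \<longlonglongrightarrow> a"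
    \<comment> \<open>The limit a is positive, so these powers stay bounded even when d < 1.\<close>
    have "(\<lambda>n. X n powr (d - 1)) \<longlonglongrightarrow> a powr (d - 1)"
      using X a by (auto intro!: tendsto_intros)
    then have "Bseq (\<lambda>n. X n powr (d - 1))"
      by (rule convergent_imp_Bseq[OF convergentI])
    then obtain K where K: "0 < K" "\<And>n. X n powr (d - 1) \<le> K"
      by (auto simp: Bseq_def)
    have C: "0 \<le> C"
      using bound[OF a] a by (smt (verit) greaterThanAtMost_iff powr_gt_zero zero_le_mult_iff)
    show "(\<lambda>n. LBINT z:{0<..<1}. (1 - z) powr (p - 1) * H (X n * z)) \<longlonglongrightarrow>
        (LBINT z:{0<..<1}. (1 - z) powr (p - 1) * H (a * z))"
      unfolding set_lebesgue_integral_def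
    proof (rule integral_dominated_convergence)
      show "integrable lborel (\<lambda>z. (C * K) * (indicator {0<..<1} z *\<^sub>R ((1 - z) powr (p - 1) * (z - 0) powr (d - 1))))"
        using beta_kernel(1)[OF p d, of 0 1] unfolding set_integrable_def by simp
      show "AE z in lborel. (\<lambda>n. indicator {0<..<1} z *\<^sub>R ((1 - z) powr (p - 1) * H (X n * z)))
          \<longlonglongrightarrow> indicator {0<..<1} z *\<^sub>R ((1 - z) powr (p - 1) * H (a * z))"
      proof (intro AE_I2)
        fix z :: real
        show "(\<lambda>n. indicator {0<..<1} z *\<^sub>R ((1 - z) powr (p - 1) * H (X n * z)))
          \<longlonglongrightarrow> indicator {0<..<1} z *\<^sub>R ((1 - z) powr (p - 1) * H (a * z))"
        proof (cases "z \<in> {0<..<1}")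
          case True
          have in_L: "w * z \<in> {0<..L}" if "w \<in> {0<..L}" for w
            using True that mult_left_le[of z w] by (auto intro!: order_trans[of "w * z" w L])
          have "(\<lambda>n. H (X n * z)) \<longlonglongrightarrow> H (a * z)"
            by (rule continuous_on_tendsto_compose[OF cont])
              (use X a in_L in \<open>auto intro!: tendsto_intros\<close>)
          then show ?thesis by (auto intro!: tendsto_intros)
        qed simp
      qed
      show "AE z in lborel. norm (indicator {0<..<1} z *\<^sub>R ((1 - z) powr (p - 1) * H (X n * z)))
          \<le> (C * K) * (indicator {0<..<1} z *\<^sub>R ((1 - z) powr (p - 1) * (z - 0) powr (d - 1)))" for n
      proof (intro AE_I2)
        fix z :: real
        show "norm (indicator {0<..<1} z *\<^sub>R ((1 - z) powr (p - 1) * H (X n * z)))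
          \<le> (C * K) * (indicator {0<..<1} z *\<^sub>R ((1 - z) powr (p - 1) * (z - 0) powr (d - 1)))"
        proof (cases "z \<in> {0<..<1}")
          case True
          have Xn: "X n \<in> {0<..L}" using X by simp
          have "X n * z \<in> {0<..L}"
            using True Xn mult_left_le[of z "X n"] by (auto intro!: order_trans[of "X n * z" "X n" L])
          then have "\<bar>H (X n * z)\<bar> \<le> C * (X n powr (d - 1) * z powr (d - 1))"
            using bound[of "X n * z"] True Xn by (simp add: powr_mult)
          also have "\<dots> \<le> C * (K * z powr (d - 1))"
            using C K(2)[of n] by (intro mult_left_mono mult_right_mono) auto
          finally have "(1 - z) powr (p - 1) * \<bar>H (X n * z)\<bar> \<le> (1 - z) powr (p - 1) * (C * (K * z powr (d - 1)))"
            by (intro mult_left_mono) auto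
          then show ?thesis using True by (simp add: abs_mult mult_ac)
        qed simp
      qed
    qed measurable
  qed
  then have "continuous_on {0<..L} (\<lambda>x. x powr p / Gamma p * (LBINT z:{0<..<1}. (1 - z) powr (p - 1) * H (x * z)))"
    using less_imp_neq[OF Gamma_real_pos[OF p]] by (intro continuous_intros) auto
  then show ?thesis
    by (rule continuous_on_eq) (use p rl_scaled in auto)
qed

section \<open>From fractional initial data to a Volterra equation\<close>

text \<open>V may be unbounded near 0, so the integral is started at x / 2. There V is continuous,
  the integral vanishes identically, and its derivative at the right end point x is both V x and
  0.\<close>

lemma continuous_eq_0_if_integrals_eq_0:
  fixes V :: "real \<Rightarrow> real"
  assumes cont: "continuous_on {0<..L} V" and int: "set_integrable lborel {0<..<L} V"
    and zero: "\<And>x. x \<in> {0<..L} \<Longrightarrow> (LBINT y:{0<..<x}. V y) = 0" and x: "x \<in> {0<..L}"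
  shows "V x = 0"
proof -
  let ?I = "\<lambda>u. integral {x / 2..u} V"
  have xL: "0 < x" "x \<le> L" using x by auto
  have cont': "continuous_on {x / 2..x} V"
    by (rule continuous_on_subset[OF cont]) (use xL in auto)
  have I0: "?I u = 0" if u: "u \<in> {x / 2..x}" for u
  proof -
    have sub: "set_integrable lborel {0<..<u} V" "set_integrable lborel {0<..<x / 2} V"
        "set_integrable lborel {x / 2..<u} V"
      by (rule set_integrable_subset[OF int]; use u xL in force)+
    have "{0<..<u} = {0<..<x / 2} \<union> {x / 2..<u}" if "x / 2 < u"
      using that xL by auto
    moreover have "{0<..<x / 2} \<inter> {x / 2..<u} = {}" by auto
    ultimately have "(LBINT y:{x / 2..<u}. V y) = 0"
      using set_integral_Un[of "{0<..<x / 2}" "{x / 2..<u}" lborel V] sub zero[of u] zero[of "x / 2"] u xL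
      by (cases "x / 2 < u") auto
    then have "integral {x / 2..<u} V = 0"
      using set_borel_integral_eq_integral(2)[OF sub(3)] by simp
    also have "integral {x / 2..<u} V = integral {x / 2..u} V"
      by (rule integral_spike_set; rule negligible_subset[of "{u}"]) auto
    finally show ?thesis .
  qed
  have "(?I has_vector_derivative V x) (at x within {x / 2..x})"
    using integral_has_vector_derivative[OF cont', of x] xL by simp
  moreover have "(?I has_vector_derivative 0) (at x within {x / 2..x})"
    by (rule has_vector_derivative_transform[OF _ _ has_vector_derivative_const[of 0]])
      (use xL I0 in auto)
  ultimately show ?thesis
    using vector_derivative_unique_within_closed_interval[of "x / 2" x x ?I "V x" 0] xL by auto
qed

lemma rl_abs_le:
  assumes "0 < p" "rl_exists p H x" "rl_exists p K x" "\<And>y. y \<in> {0<..<x} \<Longrightarrow> \<bar>H y\<bar> \<le> K y"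
  shows "\<bar>rl p H x\<bar> \<le> rl p K x"
proof (rule abs_leI)
  show "rl p H x \<le> rl p K x"
    by (rule rl_mono[OF assms(1-3)]) (use assms(4) in \<open>fastforce simp: abs_le_iff\<close>)
  have "rl p (\<lambda>y. - 1 * H y) x \<le> rl p K x"
    by (rule rl_mono[OF assms(1) rl_exists_cmult[OF assms(2)] assms(3)]) (use assms(4) in \<open>fastforce simp: abs_le_iff\<close>)
  then show "- rl p H x \<le> rl p K x" by (simp only: rl_cmult)
qed

text \<open>For p \<le> 1 the kernel is smallest at y = 0, hence bounded below by x powr (p - 1) >
  0, which can be divided out.\<close>

lemma rl_exists_imp_set_integrable:
  assumes "p \<le> 1" and [measurable]: "H \<in> borel_measurable borel" and "rl_exists p H x"
  shows "set_integrable lborel {0<..<x} H"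
proof (rule set_integrable_bound)
  show "set_integrable lborel {0<..<x} (\<lambda>y. x powr (1 - p) * ((x - y) powr (p - 1) * H y))"
    using assms(3) by simp
  show "set_borel_measurable lborel {0<..<x} H"
    unfolding set_borel_measurable_def by measurable
  show "AE y in lborel. y \<in> {0<..<x} \<longrightarrow> norm (H y) \<le> norm (x powr (1 - p) * ((x - y) powr (p - 1) * H y))"
  proof (intro AE_I2 impI)
    fix y assume y: "y \<in> {0<..<x}"
    have "1 \<le> x powr (1 - p) * x powr (p - 1)"
      using y by (simp flip: powr_add)
    also have "\<dots> \<le> x powr (1 - p) * (x - y) powr (p - 1)"
      using y assms(1) by (intro mult_left_mono powr_mono2') auto
    finally show "norm (H y) \<le> norm (x powr (1 - p) * ((x - y) powr (p - 1) * H y))"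
      using mult_right_mono[of 1 "x powr (1 - p) * (x - y) powr (p - 1)" "\<bar>H y\<bar>"] by (simp add: abs_mult mult.assoc)
  qed
qed

text \<open>Here G stands for the derivative of the integral of order 1 - \<gamma> of U, and F for
  the Hilfer derivative. The claim is first proved after one integration, where the semigroup law
  applies; continuity of the defect V then removes that integration.\<close>

lemma rl_cauchy_solution:
  fixes U F G :: "real \<Rightarrow> real"
  assumes al: "0 < \<alpha>" and mu: "0 \<le> \<mu>" and ga: "\<gamma> = \<alpha> + \<mu>" "\<gamma> \<le> 1"
    and [measurable]: "U \<in> borel_measurable borel" "F \<in> borel_measurable borel" "G \<in> borel_measurable borel"
    and contU: "continuous_on {0<..L} U" and contF: "continuous_on {0<..L} F"
    and boundU: "\<And>y. y \<in> {0<..L} \<Longrightarrow> \<bar>U y\<bar> \<le> C * y powr (\<gamma> - 1)"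
    and boundF: "\<And>y. y \<in> {0<..L} \<Longrightarrow> \<bar>F y\<bar> \<le> C' * y powr (\<gamma> - 1)"
    and intG: "set_integrable lborel {0<..<L} G"
    and F: "\<And>x. x \<in> {0<..L} \<Longrightarrow> F x = rl \<mu> G x"
    and U: "\<And>x. x \<in> {0<..L} \<Longrightarrow> rl (1 - \<gamma>) U x = c + (LBINT y:{0<..<x}. G y)"
    and x: "x \<in> {0<..L}"
  shows "U x = c * x powr (\<gamma> - 1) / Gamma \<gamma> + rl \<alpha> F x"
proof -
  have ga0: "0 < \<gamma>" using al mu ga by simp
  define P where "P = (\<lambda>y. c / Gamma \<gamma> * y powr (\<gamma> - 1))"
  define V where "V = (\<lambda>y. (U y - P y) - rl \<alpha> F y)"
  have exU: "rl_exists p U z" if "0 < p" "z \<in> {0<..L}" for p z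
    by (rule rl_exists_powr_bounded[OF that(1) ga0, where C = C]) (use boundU that in auto)
  have exF: "rl_exists p F z" if "0 < p" "z \<in> {0<..L}" for p z
    by (rule rl_exists_powr_bounded[OF that(1) ga0, where C = C']) (use boundF that in auto)
  have exG: "rl_exists p G z" if "1 \<le> p" "z \<in> {0<..L}" for p z
    by (rule rl_exists_ge_1[OF that(1)])
      (use that in \<open>auto intro: set_integrable_subset[OF intG]\<close>)
  have exP: "rl_exists p P z" if "0 < p" for p z
    unfolding P_def by (intro rl_exists_cmult rl_exists_powr that ga0)
  have exrlF: "rl_exists 1 (rl \<alpha> F) z" if "z \<in> {0<..L}" for z
    using rl_semigroup(1)[of 1 \<alpha> F z] al exF[of "1 + \<alpha>" z] that by simp
  have zero: "(LBINT y:{0<..<z}. V y) = 0" if z: "z \<in> {0<..L}" for z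
  proof -
    have "rl 1 U z = rl \<gamma> (rl (1 - \<gamma>) U) z"
      using rl_semigroup'[of \<gamma> "1 - \<gamma>" U z] ga ga0 exU[of 1 z] z by simp
    \<comment> \<open>The constant c is written with y powr (1 - 1) so that the power rule applies
      with d = 1.\<close>
    also have "\<dots> = rl \<gamma> (\<lambda>y. c * y powr (1 - 1) + rl 1 G y) z"
      using U z by (intro rl_cong ga0) (auto simp: rl_1)
    also have "\<dots> = rl \<gamma> (\<lambda>y. c * y powr (1 - 1)) z + rl \<gamma> (rl 1 G) z"
      using rl_semigroup(1)[of \<gamma> 1 G z] exG[of "\<gamma> + 1" z] z ga0
      by (intro rl_add rl_exists_cmult rl_exists_powr ga0) auto
    also have "rl \<gamma> (\<lambda>y. c * y powr (1 - 1)) z = c * (1 / Gamma (\<gamma> + 1) * z powr \<gamma>)"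
      using rl_powr[of \<gamma> 1 z] ga0 z unfolding rl_cmult by simp
    also have "\<dots> = rl 1 P z"
      using rl_powr[of 1 \<gamma> z] ga0 z less_imp_neq[OF Gamma_real_pos[OF ga0]] unfolding P_def rl_cmult by (simp add: add_ac)
    \<comment> \<open>G is only known to be integrable, so the total order applied to it is kept at
      least 1. The order \<gamma> + 1 is regrouped as (\<alpha> + 1) + \<mu>, whose inner part of
      order \<mu> is F.\<close>
    also have "rl \<gamma> (rl 1 G) z = rl ((\<alpha> + 1) + \<mu>) G z"
      using rl_semigroup'[of \<gamma> 1 G z] exG[of "\<gamma> + 1" z] z ga0 by (simp add: ga add_ac)
    also have "\<dots> = rl (\<alpha> + 1) (rl \<mu> G) z"
      using rl_semigroup'[of "\<alpha> + 1" \<mu> G z] exG[of "(\<alpha> + 1) + \<mu>" z] z al mu by simp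
    also have "\<dots> = rl (\<alpha> + 1) F z"
      using F z al by (intro rl_cong) auto
    also have "\<dots> = rl 1 (rl \<alpha> F) z"
      using rl_semigroup'[of 1 \<alpha> F z] exF[of "1 + \<alpha>" z] z al by (simp add: add_ac)
    finally have "rl 1 U z = rl 1 P z + rl 1 (rl \<alpha> F) z" .
    then have "rl 1 V z = 0"
      unfolding V_def using exU[of 1 z] exP[of 1 z] exrlF[of z] z
      by (subst rl_diff | intro rl_exists_diff | simp)+
    then show ?thesis by (simp add: rl_1)
  qed
  have "V x = 0"
  proof (rule continuous_eq_0_if_integrals_eq_0[OF _ _ zero x])
    show "continuous_on {0<..L} V"
      unfolding V_def P_def
      by (intro continuous_intros contU continuous_on_rl[OF al ga0 _ contF boundF]) auto
    show "set_integrable lborel {0<..<L} V"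
      using exU[of 1 L] exP[of 1 L] exrlF[of L] x unfolding rl_exists_1 V_def
      by (intro set_integral_diff) auto
  qed
  then show ?thesis by (simp add: V_def P_def)
qed

section \<open>The Gamma function and the fractional Gronwall inequality\<close>

text \<open>Euler's integral is cut down to t \<ge> R, where t powr (x - 1) is at least R powr (x -
  1) because x \<ge> 1.\<close>

lemma Gamma_real_lower_bound:
  fixes R x :: real
  assumes "0 < R" "1 \<le> x"
  shows "R powr (x - 1) * exp (- R) \<le> Gamma x"
proof -
  have G: "((\<lambda>t. t powr (x - 1) / exp t) has_integral Gamma x) {0..}"
    using Gamma_integral_real[of x] assms by simp
  have E: "((\<lambda>t. R powr (x - 1) * exp (- 1 * t)) has_integral R powr (x - 1) * (exp (- 1 * R) / 1)) {R..}"
    by (intro has_integral_mult_right has_integral_exp_minus_to_infinity) auto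
  have "{R..} \<subseteq> {0..}" using assms by auto
  note E' = E[folded has_integral_restrict[OF this]]
  have "R powr (x - 1) * (exp (- 1 * R) / 1) \<le> Gamma x"
    by (rule has_integral_le[OF E' G])
      (use assms in \<open>auto simp: exp_minus field_simps intro!: powr_mono2\<close>)
  then show ?thesis by simp
qed

text \<open>These are the terms of the two-parameter Mittag-Leffler function. The lower bound for
  Gamma with a large fixed R gives comparison with a geometric series.\<close>

lemma summable_Mittag_Leffler:
  fixes \<nu> d z :: real
  assumes nu: "0 < \<nu>" and d: "0 < d"
  shows "summable (\<lambda>n. z ^ n / Gamma (real n * \<nu> + d))"
proof -
  \<comment> \<open>Chosen so that R powr \<nu> beats \<bar>z\<bar> by a factor of at least 2, which
    produces the ratio 1/2; the summand 1 keeps R positive for z = 0.\<close>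
  define R where "R = (2 * (\<bar>z\<bar> + 1)) powr (1 / \<nu>)"
  have R: "0 < R" "R powr \<nu> = 2 * (\<bar>z\<bar> + 1)"
    using nu by (auto simp: R_def powr_powr)
  \<comment> \<open>The inverse of the part of the Gamma bound that does not depend on n.\<close>
  define K where "K = R powr (1 - d) * exp R"
  \<comment> \<open>From this index on n * \<nu> exceeds 1, so the Gamma bound is
    applicable.\<close>
  obtain N :: nat where N: "1 / \<nu> < real N" using reals_Archimedean2 by blast
  show ?thesis
  proof (rule summable_comparison_test)
    show "summable (\<lambda>n. K * (1 / 2 :: real) ^ n)"
      by (intro summable_mult summable_geometric) auto
    have "norm (z ^ n / Gamma (real n * \<nu> + d)) \<le> K * (1 / 2) ^ n" if n: "N \<le> n" for n
    proof -
      have "1 < real n * \<nu>"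
      proof -
        have "1 / \<nu> < real n" using N n by linarith
        then show ?thesis using nu by (simp add: field_simps)
      qed
      then have g: "R powr (real n * \<nu> + d - 1) * exp (- R) \<le> Gamma (real n * \<nu> + d)"
        using R d by (intro Gamma_real_lower_bound) auto
      have "R powr (real n * \<nu> + d - 1) = (R powr \<nu>) powr real n * R powr (d - 1)"
        by (simp add: powr_powr mult.commute flip: powr_add) (simp add: algebra_simps)
      also have "(R powr \<nu>) powr real n = (2 * (\<bar>z\<bar> + 1)) ^ n"
        by (subst R(2), rule powr_realpow) auto
      finally have e: "R powr (real n * \<nu> + d - 1) * exp (- R) = 2 ^ n * (\<bar>z\<bar> + 1) ^ n / K"
        using R(1) by (simp only: power_mult_distrib) (simp add: K_def powr_diff exp_minus field_simps)
      have K: "0 < K" using R by (simp add: K_def)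
      have "\<bar>z\<bar> ^ n \<le> (\<bar>z\<bar> + 1) ^ n" by (intro power_mono) auto
      also have "\<dots> = K * (1 / 2) ^ n * (2 ^ n * (\<bar>z\<bar> + 1) ^ n / K)"
        using K by (simp add: power_one_over)
      also have "\<dots> \<le> K * (1 / 2) ^ n * Gamma (real n * \<nu> + d)"
        using g K unfolding e by (intro mult_left_mono) auto
      finally have "\<bar>z\<bar> ^ n \<le> K * (1 / 2) ^ n * Gamma (real n * \<nu> + d)" .
      moreover have "0 < Gamma (real n * \<nu> + d)"
        using nu d by (intro Gamma_real_pos) (simp add: add_nonneg_pos)
      ultimately show ?thesis
        by (simp add: abs_mult power_abs pos_divide_le_eq)
    qed
    then show "\<exists>N. \<forall>n\<ge>N. norm (z ^ n / Gamma (real n * \<nu> + d)) \<le> K * (1 / 2) ^ n"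
      by blast
  qed
qed

text \<open>Log-convexity on the chord from w to 2. Since Gamma takes the value 1 at 2, the point z
  between them satisfies ln (Gamma z) \<le> (1 - \<theta>) ln (Gamma w) with \<theta> = (z - w) / (2
  - w).\<close>

lemma Gamma_real_antimono:
  fixes x y :: real
  assumes "0 < x" "x \<le> y" "y \<le> 1"
  shows "Gamma y \<le> Gamma x"
proof -
  have aux: "ln (Gamma z) \<le> (1 - (z - w) / (2 - w)) * ln (Gamma w)" if "0 < w" "w \<le> z" "z \<le> 1" for w z :: real
  proof -
    have "0 \<le> (z - w) / (2 - w)" "(z - w) / (2 - w) \<le> 1"
      using that by (simp_all add: divide_le_eq)
    moreover have "(1 - (z - w) / (2 - w)) * w + (z - w) / (2 - w) * 2 = w + (z - w) / (2 - w) * (2 - w)"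
      by (simp only: left_diff_distrib right_diff_distrib)
    then have "(1 - (z - w) / (2 - w)) * w + (z - w) / (2 - w) * 2 = z"
      using that by simp
    ultimately show ?thesis
      using convex_onD[OF log_convex_Gamma_real, of "(z - w) / (2 - w)" w 2] that
      by (simp add: Gamma_numeral)
  qed
  \<comment> \<open>At z = 1 the left side of \<open>aux\<close> is ln 1 = 0. This yields the sign
    of ln (Gamma x), without which the factor 1 - \<theta> could not be dropped.\<close>
  have "0 \<le> (1 - (1 - x) / (2 - x)) * ln (Gamma x)" "(1 - x) / (2 - x) < 1"
    using aux[of x 1] assms by (simp_all add: divide_less_eq)
  then have nonneg: "0 \<le> ln (Gamma x)"
    by (simp add: zero_le_mult_iff)
  have "ln (Gamma y) \<le> (1 - (y - x) / (2 - x)) * ln (Gamma x)"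
    by (rule aux[OF assms])
  also have "\<dots> \<le> ln (Gamma x)"
    using assms nonneg by (intro mult_left_le_one_le) (auto simp: divide_le_eq)
  finally show ?thesis using assms by (simp add: Gamma_real_pos)
qed

lemma Gamma_real_ge_1:
  fixes x :: real
  assumes "0 < x" "x \<le> 1"
  shows "1 \<le> Gamma x"
  using Gamma_real_antimono[of x 1] assms by simp

text \<open>
  The difference of the two kernels changes sign, so the right-hand side is not simply the integral of
  its absolute value.  Up to the factor \<open>N\<close>, with \<open>p\<close>, \<open>q\<close>, \<open>r\<close> the three terms on the right, that integral is \<open>p + r\<close> minus twice the
  integral of the smaller kernel, the right-hand side is at least \<open>p + r - 2 min q r\<close>, and the
  smaller kernel dominates \<open>m (x - y)\<^sup>\<alpha>\<^sup>-\<^sup>1\<close>, whose integral is at least \<open>min q r\<close> because \<open>\<Gamma>(\<alpha>) \<ge> 1 \<ge> \<alpha>\<close>.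
\<close>
lemma rl_order_difference:
  fixes \<alpha> \<nu> x N :: real
  assumes nu: "0 < \<nu>" "\<nu> < \<alpha>" and al: "\<alpha> \<le> 1" and x: "0 < x"
    and [measurable]: "F \<in> borel_measurable borel"
    and F: "\<And>y. y \<in> {0<..<x} \<Longrightarrow> \<bar>F y\<bar> \<le> N"
  shows "\<bar>rl \<nu> F x - rl \<alpha> F x\<bar> \<le>
    N * \<bar>x powr \<nu> / Gamma (\<nu> + 1) - x powr \<nu> / (Gamma \<nu> * Gamma \<alpha>)\<bar>
    + N * \<bar>x powr \<nu> / (Gamma \<nu> * Gamma \<alpha>) - x powr \<alpha> / Gamma (\<alpha> + 1)\<bar>"
proof -
  have al0: "0 < \<alpha>" using nu by simp
  have G: "0 < Gamma \<nu>" "0 < Gamma \<alpha>" using nu al0 by (auto intro: Gamma_real_pos)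
  have N: "0 \<le> N" using F[of "x / 2"] x by fastforce
  define p where "p = x powr \<nu> / Gamma (\<nu> + 1)"
  define q where "q = x powr \<nu> / (Gamma \<nu> * Gamma \<alpha>)"
  define r where "r = x powr \<alpha> / Gamma (\<alpha> + 1)"
  define m where "m = min (x powr (\<nu> - \<alpha>) / Gamma \<nu>) (1 / Gamma \<alpha>)"
  \<comment> \<open>Pointwise the distance of two numbers is their sum minus twice their minimum.
    Replacing the minimum of the two kernels by the smaller quantity m * (x - y) powr (\<alpha> - 1)
    gives a majorant with an explicit integral.\<close>
  define k where "k = (\<lambda>y. (x - y) powr (\<nu> - 1) / Gamma \<nu> + (x - y) powr (\<alpha> - 1) / Gamma \<alpha> - 2 * m * (x - y) powr (\<alpha> - 1))"
  have base: "set_integrable lborel {0<..<x} (\<lambda>y. (x - y) powr (d - 1))"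
     "(LBINT y:{0<..<x}. (x - y) powr (d - 1)) = x powr d / d" if "0 < d" for d
  proof -
    have "(LBINT y:{0<..<x}. (x - y) powr (d - 1) * (y - 0) powr (1 - 1)) = (LBINT y:{0<..<x}. (x - y) powr (d - 1))"
      by (auto intro!: set_lebesgue_integral_cong)
    moreover have "Gamma (d + 1) = d * Gamma d" using that by (intro Gamma_plus1) (auto elim: nonpos_Ints_cases)
    ultimately show "(LBINT y:{0<..<x}. (x - y) powr (d - 1)) = x powr d / d"
      using beta_kernel(2)[of d 1 0 x] that x less_imp_neq[OF Gamma_real_pos[OF that]]
      by (simp add: Beta_def)
    have "set_integrable lborel {0<..<x} (\<lambda>y. (x - y) powr (d - 1) * (y - 0) powr (1 - 1))"
      using beta_kernel(1)[of d 1 0 x] that x by simp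
    also have "?this \<longleftrightarrow> set_integrable lborel {0<..<x} (\<lambda>y. (x - y) powr (d - 1))"
      by (intro set_integrable_cong) auto
    finally show "set_integrable lborel {0<..<x} (\<lambda>y. (x - y) powr (d - 1))" .
  qed
  have plus1: "Gamma (d + 1) = d * Gamma d" if "0 < d" for d :: real
    using that by (intro Gamma_plus1) (auto elim: nonpos_Ints_cases)
  have k_int: "set_integrable lborel {0<..<x} k"
    unfolding k_def by (intro set_integral_diff set_integral_add set_integrable_divide set_integrable_mult_right base nu al0)
  have k_val: "(LBINT y:{0<..<x}. k y) = p + r - 2 * (m * (x powr \<alpha> / \<alpha>))"
    unfolding k_def
    by (subst set_integral_diff(2) set_integral_add(2);
        (intro set_integral_add set_integrable_divide set_integrable_mult_right base nu al0)?)+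
      (use nu al0 in \<open>simp add: base p_def r_def plus1 mult_ac\<close>)
  have k_bound: "\<bar>(x - y) powr (\<nu> - 1) / Gamma \<nu> - (x - y) powr (\<alpha> - 1) / Gamma \<alpha>\<bar> \<le> k y" if y: "y \<in> {0<..<x}" for y
  proof -
    let ?z = "x - y"
    have "m * ?z powr (\<alpha> - 1) \<le> 1 / Gamma \<alpha> * ?z powr (\<alpha> - 1)"
      by (intro mult_right_mono) (auto simp: m_def)
    moreover have "m * ?z powr (\<alpha> - 1) \<le> ?z powr (\<nu> - 1) / Gamma \<nu>"
    proof -
      have "m * ?z powr (\<alpha> - 1) \<le> x powr (\<nu> - \<alpha>) / Gamma \<nu> * ?z powr (\<alpha> - 1)"
        by (intro mult_right_mono) (auto simp: m_def)
      also have "\<dots> \<le> ?z powr (\<nu> - \<alpha>) / Gamma \<nu> * ?z powr (\<alpha> - 1)"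
        using y nu G by (intro mult_right_mono divide_right_mono powr_mono2') auto
      also have "\<dots> = ?z powr (\<nu> - 1) / Gamma \<nu>"
        by (simp flip: powr_add)
      finally show ?thesis .
    qed
    ultimately show ?thesis unfolding k_def by (simp add: abs_le_iff)
  qed
  have min_le: "min q r \<le> m * (x powr \<alpha> / \<alpha>)"
  proof -
    have "m = x powr (\<nu> - \<alpha>) / Gamma \<nu> \<or> m = 1 / Gamma \<alpha>"
      by (auto simp: m_def min_def)
    moreover have "x powr (\<nu> - \<alpha>) / Gamma \<nu> * (x powr \<alpha> / \<alpha>) = x powr \<nu> / (Gamma \<nu> * \<alpha>)"
      using x by (simp flip: powr_add)
    moreover have "1 / Gamma \<alpha> * (x powr \<alpha> / \<alpha>) = r"
      using al0 by (simp add: r_def plus1)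
    moreover have "q \<le> x powr \<nu> / (Gamma \<nu> * \<alpha>)"
      unfolding q_def using G al0 Gamma_real_ge_1[OF al0 al] al by (intro divide_left_mono mult_left_mono mult_pos_pos) auto
    ultimately show ?thesis by auto
  qed
  have exF: "rl_exists d F x" if "0 < d" for d
    by (rule rl_exists_powr_bounded[OF that, of 1 F x N]) (use F in auto)
  have "rl \<nu> F x - rl \<alpha> F x = (LBINT y:{0<..<x}. (x - y) powr (\<nu> - 1) * F y / Gamma \<nu>) - (LBINT y:{0<..<x}. (x - y) powr (\<alpha> - 1) * F y / Gamma \<alpha>)"
    using nu al0 by (simp add: rl_def)
  also have "\<dots> = (LBINT y:{0<..<x}. (x - y) powr (\<nu> - 1) * F y / Gamma \<nu> - (x - y) powr (\<alpha> - 1) * F y / Gamma \<alpha>)"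
    by (subst set_integral_diff(2)) (auto intro!: set_integrable_divide exF nu al0)
  finally have "\<bar>rl \<nu> F x - rl \<alpha> F x\<bar> = \<bar>LBINT y:{0<..<x}. (x - y) powr (\<nu> - 1) * F y / Gamma \<nu> - (x - y) powr (\<alpha> - 1) * F y / Gamma \<alpha>\<bar>"
    by (rule arg_cong)
  also have "\<dots> \<le> (LBINT y:{0<..<x}. \<bar>(x - y) powr (\<nu> - 1) * F y / Gamma \<nu> - (x - y) powr (\<alpha> - 1) * F y / Gamma \<alpha>\<bar>)"
    unfolding real_norm_def[symmetric] by (rule set_integral_norm_bound)
      (intro set_integral_diff set_integrable_divide exF nu al0)
  also have "\<dots> \<le> (LBINT y:{0<..<x}. N * k y)"
  proof (rule set_integral_mono)
    show "set_integrable lborel {0<..<x} (\<lambda>y. \<bar>(x - y) powr (\<nu> - 1) * F y / Gamma \<nu> - (x - y) powr (\<alpha> - 1) * F y / Gamma \<alpha>\<bar>)"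
      by (intro set_integrable_abs set_integral_diff set_integrable_divide exF nu al0)
    show "set_integrable lborel {0<..<x} (\<lambda>y. N * k y)"
      using k_int by simp
    fix y assume y: "y \<in> {0<..<x}"
    have "\<bar>(x - y) powr (\<nu> - 1) * F y / Gamma \<nu> - (x - y) powr (\<alpha> - 1) * F y / Gamma \<alpha>\<bar>
      = \<bar>F y\<bar> * \<bar>(x - y) powr (\<nu> - 1) / Gamma \<nu> - (x - y) powr (\<alpha> - 1) / Gamma \<alpha>\<bar>"
      unfolding abs_mult[symmetric] by (simp add: algebra_simps)
    also have "\<dots> \<le> N * k y"
      using F[OF y] k_bound[OF y] N by (intro mult_mono) auto
    finally show "\<bar>(x - y) powr (\<nu> - 1) * F y / Gamma \<nu> - (x - y) powr (\<alpha> - 1) * F y / Gamma \<alpha>\<bar> \<le> N * k y" .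
  qed
  also have "\<dots> = N * (p + r - 2 * (m * (x powr \<alpha> / \<alpha>)))"
    using k_val by simp
  also have "\<dots> \<le> N * (\<bar>p - q\<bar> + \<bar>q - r\<bar>)"
    using min_le by (intro mult_left_mono N) (auto simp: min_def split: if_splits)
  finally show ?thesis by (simp add: p_def q_def r_def distrib_left)
qed

section \<open>The resolvent series and the Gronwall inequality\<close>

text \<open>After extracting c * z powr (\<nu> - 1) * y the terms are those of the Mittag-Leffler
  series with d = \<nu> at the point c * z powr \<nu>.\<close>

lemma summable_resolvent_kernel:
  fixes \<nu> c y z :: real
  assumes nu: "0 < \<nu>" and z: "0 < z"
  shows "summable (\<lambda>n. c ^ Suc n * (z powr (real (Suc n) * \<nu> - 1) / Gamma (real (Suc n) * \<nu>) * y))"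
proof -
  have "summable (\<lambda>n. (c * z powr (\<nu> - 1) * y) * ((c * z powr \<nu>) ^ n / Gamma (real n * \<nu> + \<nu>)))"
    by (intro summable_mult summable_Mittag_Leffler nu)
  also have "(\<lambda>n. (c * z powr (\<nu> - 1) * y) * ((c * z powr \<nu>) ^ n / Gamma (real n * \<nu> + \<nu>))) =
    (\<lambda>n. c ^ Suc n * (z powr (real (Suc n) * \<nu> - 1) / Gamma (real (Suc n) * \<nu>) * y))"
  proof
    fix n
    have "z powr (real (Suc n) * \<nu> - 1) = z powr (\<nu> - 1) * (z powr \<nu>) ^ n"
      using z by (simp add: powr_powr algebra_simps flip: powr_realpow powr_add)
    then show "(c * z powr (\<nu> - 1) * y) * ((c * z powr \<nu>) ^ n / Gamma (real n * \<nu> + \<nu>)) =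
        c ^ Suc n * (z powr (real (Suc n) * \<nu> - 1) / Gamma (real (Suc n) * \<nu>) * y)"
      by (simp add: power_mult_distrib algebra_simps)
  qed
  finally show ?thesis .
qed

text \<open>Repeated insertion of the inequality into itself gives a finite sum of iterated
  integrals of A and a remainder in D. The growth bounds on D and A make the remainder vanish and
  the sum converge, both by comparison with Mittag-Leffler terms; nonnegativity then lets sum and
  integral be exchanged.\<close>

lemma fractional_gronwall:
  fixes \<nu> d c C C' L :: real and D A :: "real \<Rightarrow> real"
  assumes nu: "0 < \<nu>" and d: "0 < d" and c: "0 \<le> c"
    and [measurable]: "D \<in> borel_measurable borel" "A \<in> borel_measurable borel"
    and D0: "\<And>y. y \<in> {0<..L} \<Longrightarrow> 0 \<le> D y" and A0: "\<And>y. y \<in> {0<..L} \<Longrightarrow> 0 \<le> A y"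
    and boundD: "\<And>y. y \<in> {0<..L} \<Longrightarrow> D y \<le> C * y powr (d - 1)"
    and boundA: "\<And>y. y \<in> {0<..L} \<Longrightarrow> A y \<le> C' * y powr (d - 1)"
    and le: "\<And>y. y \<in> {0<..L} \<Longrightarrow> D y \<le> A y + c * rl \<nu> D y"
    and x: "x \<in> {0<..L}"
  shows "D x \<le> A x + (LBINT y:{0<..<x}. (\<Sum>n. c ^ Suc n *
      ((x - y) powr (real (Suc n) * \<nu> - 1) / Gamma (real (Suc n) * \<nu>) * A y)))"
proof -
  have exD: "rl_exists p D z" if "0 < p" "z \<in> {0<..L}" for p z
    by (rule rl_exists_powr_bounded[OF that(1) d, where C = C]) (use boundD D0 that in auto)
  have exA: "rl_exists p A z" if "0 < p" "z \<in> {0<..L}" for p z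
    by (rule rl_exists_powr_bounded[OF that(1) d, where C = C']) (use boundA A0 that in auto)
  have iter: "D z \<le> (\<Sum>j<n. c ^ j * rl (real j * \<nu>) A z) + c ^ n * rl (real n * \<nu>) D z"
    if z: "z \<in> {0<..L}" for n z
  proof (induction n)
    case (Suc n)
    have "rl (real n * \<nu>) D z \<le> rl (real n * \<nu>) A z + c * rl (real (Suc n) * \<nu>) D z"
    \<comment> \<open>Monotonicity of the integral of order n * \<nu> is available for positive
      order; for n = 0 the integral is the identity and the claim is the hypothesis
      \<open>le\<close>.\<close>
    proof (cases "n = 0")
      case False
      then have n: "0 < real n * \<nu>" using nu by simp
      have exrl: "rl_exists (real n * \<nu>) (rl \<nu> D) z"
        using rl_semigroup(1)[OF n nu _ exD] z n nu by simp
      have "rl (real n * \<nu>) D z \<le> rl (real n * \<nu>) (\<lambda>y. A y + c * rl \<nu> D y) z"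
        by (intro rl_mono n exD rl_exists_add exA rl_exists_cmult exrl z le) (use z in auto)
      also have "\<dots> = rl (real n * \<nu>) A z + c * rl (real n * \<nu>) (rl \<nu> D) z"
        by (subst rl_add) (auto intro: n exA rl_exists_cmult exrl z simp: rl_cmult)
      also have "rl (real n * \<nu>) (rl \<nu> D) z = rl (real (Suc n) * \<nu>) D z"
        using rl_semigroup(2)[OF n nu _ exD] z n nu by (simp add: algebra_simps)
      finally show ?thesis .
    qed (use le[OF z] in simp)
    then have "c ^ n * rl (real n * \<nu>) D z \<le> c ^ n * (rl (real n * \<nu>) A z + c * rl (real (Suc n) * \<nu>) D z)"
      using c by (intro mult_left_mono) auto
    then show ?case using Suc by (simp add: distrib_left mult_ac)
  qed simp
  have bound: "rl p H x \<le> B * (Gamma d / Gamma (p + d) * x powr (p + d - 1))"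
    if "0 < p" "rl_exists p H x" "\<And>y. y \<in> {0<..L} \<Longrightarrow> H y \<le> B * y powr (d - 1)" for p H B
  proof -
    have "rl p H x \<le> rl p (\<lambda>y. B * y powr (d - 1)) x"
      using that x by (intro rl_mono rl_exists_cmult rl_exists_powr d) auto
    then show ?thesis using rl_powr[OF that(1) d, of x] x by (simp add: rl_cmult)
  qed
  have summ: "summable (\<lambda>n. c ^ n * (B * (Gamma d / Gamma (real n * \<nu> + d) * x powr (real n * \<nu> + d - 1))))" for B
  proof -
    have "summable (\<lambda>n. (B * Gamma d * x powr (d - 1)) * ((c * x powr \<nu>) ^ n / Gamma (real n * \<nu> + d)))"
      by (intro summable_mult summable_Mittag_Leffler nu d)
    also have "(\<lambda>n. (B * Gamma d * x powr (d - 1)) * ((c * x powr \<nu>) ^ n / Gamma (real n * \<nu> + d)))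
      = (\<lambda>n. c ^ n * (B * (Gamma d / Gamma (real n * \<nu> + d) * x powr (real n * \<nu> + d - 1))))"
    proof
      fix n
      have "x powr (real n * \<nu> + d - 1) = x powr (d - 1) * (x powr \<nu>) ^ n"
        using x by (simp add: powr_powr algebra_simps flip: powr_realpow powr_add)
      then show "(B * Gamma d * x powr (d - 1)) * ((c * x powr \<nu>) ^ n / Gamma (real n * \<nu> + d))
        = c ^ n * (B * (Gamma d / Gamma (real n * \<nu> + d) * x powr (real n * \<nu> + d - 1)))"
        by (simp add: power_mult_distrib)
    qed
    finally show ?thesis .
  qed
  \<comment> \<open>The upper bound is the general term of the convergent series
    \<open>summ\<close>, hence tends to 0.\<close>
  have rem: "(\<lambda>n. c ^ n * rl (real n * \<nu>) D x) \<longlonglongrightarrow> 0"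
  proof (rule tendsto_sandwich[OF _ _ tendsto_const summable_LIMSEQ_zero[OF summ[of C]]])
    show "\<forall>\<^sub>F n in sequentially. 0 \<le> c ^ n * rl (real n * \<nu>) D x"
      using eventually_gt_at_top[of 0]
      by eventually_elim (use nu D0 x c in \<open>auto intro!: mult_nonneg_nonneg rl_nonneg\<close>)
    show "\<forall>\<^sub>F n in sequentially. c ^ n * rl (real n * \<nu>) D x
       \<le> c ^ n * (C * (Gamma d / Gamma (real n * \<nu> + d) * x powr (real n * \<nu> + d - 1)))"
      using eventually_gt_at_top[of 0]
      by eventually_elim (rule mult_left_mono[OF bound[OF _ exD boundD]]; use nu x c in auto)
  qed
  have term_nonneg: "0 \<le> c ^ Suc n * rl (real (Suc n) * \<nu>) A x" for n
    using nu A0 x c by (intro mult_nonneg_nonneg rl_nonneg) auto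
  have summA: "summable (\<lambda>n. c ^ Suc n * rl (real (Suc n) * \<nu>) A x)"
  proof (rule summable_comparison_test)
    show "summable (\<lambda>n. c ^ Suc n * (C' * (Gamma d / Gamma (real (Suc n) * \<nu> + d) * x powr (real (Suc n) * \<nu> + d - 1))))"
      using summ[of C'] by (subst summable_Suc_iff)
    show "\<exists>N. \<forall>n\<ge>N. norm (c ^ Suc n * rl (real (Suc n) * \<nu>) A x)
       \<le> c ^ Suc n * (C' * (Gamma d / Gamma (real (Suc n) * \<nu> + d) * x powr (real (Suc n) * \<nu> + d - 1)))"
      unfolding real_norm_def abs_of_nonneg[OF term_nonneg]
      by (intro exI allI impI; rule mult_left_mono[OF bound[OF _ exA boundA]]; use nu x c in \<open>auto simp del: of_nat_Suc\<close>)
  qed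
  let ?t = "\<lambda>n y. c ^ Suc n * ((x - y) powr (real (Suc n) * \<nu> - 1) / Gamma (real (Suc n) * \<nu>) * A y)"
  have t_int: "set_integrable lborel {0<..<x} (?t n)" for n
    using exA[of "real (Suc n) * \<nu>" x] nu x
    by (auto intro!: set_integrable_mult_right simp del: of_nat_Suc simp: times_divide_eq_left)
  have t_val: "(LBINT y:{0<..<x}. ?t n y) = c ^ Suc n * rl (real (Suc n) * \<nu>) A x" for n
    using nu by (simp add: rl_def del: of_nat_Suc power_Suc)
  have t_nonneg: "0 \<le> ?t n y" if "y \<in> {0<..<x}" for n y
    using that c A0[of y] x nu Gamma_real_pos[of "real (Suc n) * \<nu>"] by (auto simp del: of_nat_Suc power_Suc)
  have t_summ: "summable (\<lambda>n. ?t n y)" if "y \<in> {0<..<x}" for y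
    using that by (intro summable_resolvent_kernel nu) auto
  \<comment> \<open>The terms are nonnegative, so the integrals of their norms are the summands of
    the convergent series \<open>summA\<close>, as the exchange requires.\<close>
  have "(\<integral>y. (\<Sum>n. indicator {0<..<x} y *\<^sub>R ?t n y) \<partial>lborel) = (\<Sum>n. \<integral>y. indicator {0<..<x} y *\<^sub>R ?t n y \<partial>lborel)"
  proof (rule integral_suminf)
    show "integrable lborel (\<lambda>y. indicator {0<..<x} y *\<^sub>R ?t n y)" for n
      using t_int[of n] unfolding set_integrable_def .
    have norm_eq: "norm (indicator {0<..<x} y *\<^sub>R ?t n y) = indicator {0<..<x} y *\<^sub>R ?t n y" for n y
      unfolding real_norm_def
    proof (rule abs_of_nonneg)
      show "0 \<le> indicator {0<..<x} y *\<^sub>R ?t n y"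
        using t_nonneg[of y n] by (cases "y \<in> {0<..<x}") (simp_all only: indicator_simps scaleR_one scaleR_zero_left order_refl not_False_eq_True)
    qed
    show "AE y in lborel. summable (\<lambda>n. norm (indicator {0<..<x} y *\<^sub>R ?t n y))"
      unfolding norm_eq
    proof (intro AE_I2)
      fix y
      show "summable (\<lambda>n. indicator {0<..<x} y *\<^sub>R ?t n y)"
        using t_summ[of y] by (cases "y \<in> {0<..<x}") simp_all
    qed
    have "(LBINT y. norm (indicator {0<..<x} y *\<^sub>R ?t n y)) = (LBINT y:{0<..<x}. ?t n y)" for n
      unfolding norm_eq set_lebesgue_integral_def ..
    then show "summable (\<lambda>n. LBINT y. norm (indicator {0<..<x} y *\<^sub>R ?t n y))"
      using summA unfolding t_val by simp
  qed
  moreover have "(\<Sum>n. indicator {0<..<x} y *\<^sub>R ?t n y) = indicator {0<..<x} y *\<^sub>R (\<Sum>n. ?t n y)" for y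
    by (cases "y \<in> {0<..<x}") auto
  ultimately have series: "(LBINT y:{0<..<x}. (\<Sum>n. ?t n y)) = (\<Sum>n. c ^ Suc n * rl (real (Suc n) * \<nu>) A x)"
    unfolding t_val[symmetric] by (simp only: set_lebesgue_integral_def)
  \<comment> \<open>The term j = 0 has order 0 and is A x itself; it is split off, so the remaining
    series starts at exponent 1.\<close>
  have "(\<lambda>n. (\<Sum>j<Suc n. c ^ j * rl (real j * \<nu>) A x) + c ^ Suc n * rl (real (Suc n) * \<nu>) D x)
     \<longlonglongrightarrow> (A x + (\<Sum>n. c ^ Suc n * rl (real (Suc n) * \<nu>) A x)) + 0"
  proof (rule tendsto_add[OF _ LIMSEQ_Suc[OF rem]])
    have "(\<lambda>n. A x + (\<Sum>j<n. c ^ Suc j * rl (real (Suc j) * \<nu>) A x)) \<longlonglongrightarrow> A x + (\<Sum>n. c ^ Suc n * rl (real (Suc n) * \<nu>) A x)"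
      by (intro tendsto_intros summable_LIMSEQ[OF summA])
    then show "(\<lambda>n. \<Sum>j<Suc n. c ^ j * rl (real j * \<nu>) A x) \<longlonglongrightarrow> A x + (\<Sum>n. c ^ Suc n * rl (real (Suc n) * \<nu>) A x)"
      by (subst sum.lessThan_Suc_shift) simp
  qed
  then have "D x \<le> (A x + (\<Sum>n. c ^ Suc n * rl (real (Suc n) * \<nu>) A x)) + 0"
    by (rule LIMSEQ_le_const) (use iter[OF x] in blast)
  then show ?thesis using series by simp
qed

section \<open>Change of variables\<close>

text \<open>The derivative is a pointwise limit of difference quotients that are continuous in s.
  The auxiliary points approach s from the left, so they stay in the interval also for s =
  b.\<close>

lemma borel_measurable_deriv_on:
  fixes h :: "real \<Rightarrow> real"
  assumes diff: "\<And>s. s \<in> {a<..b} \<Longrightarrow> h differentiable (at s within {a..b})"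
  shows "(\<lambda>s. indicator {a<..b} s * deriv_on a b h s) \<in> borel_measurable borel"
proof -
  \<comment> \<open>The denominator n + 2 keeps q n s strictly between a and s for every n; with n +
    1 the first point would be a, where h need not be continuous.\<close>
  define q where "q = (\<lambda>(n::nat) s. s - (s - a) / (real n + 2))"
  have q_in: "q n s \<in> {a<..b} - {s}" if "s \<in> {a<..b}" for n s
  proof -
    have "(s - a) / (real n + 2) < s - a" using that by (simp add: divide_less_eq)
    moreover have "0 < (s - a) / (real n + 2)" using that by simp
    ultimately show ?thesis using that by (simp add: q_def)
  qed
  have cont: "continuous_on {a<..b} h"
    unfolding continuous_on_eq_continuous_within
    using diff by (meson continuous_within_subset differentiable_imp_continuous_within greaterThanAtMost_subseteq_atLeastAtMost_iff order_refl)
  show ?thesis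
  proof (rule borel_measurable_LIMSEQ_real)
    fix n :: nat
    have "continuous_on {a<..b} (\<lambda>s. (h s - h (q n s)) / (s - q n s))"
      using q_in by (intro continuous_intros cont continuous_on_compose2[OF cont]) (auto simp: q_def intro!: continuous_intros)
    then show "(\<lambda>s. indicator {a<..b} s * ((h s - h (q n s)) / (s - q n s))) \<in> borel_measurable borel"
      using borel_measurable_continuous_on_indicator[of "{a<..b}" "\<lambda>s. (h s - h (q n s)) / (s - q n s)"] by simp
  next
    fix s :: real
    show "(\<lambda>n. indicator {a<..b} s * ((h s - h (q n s)) / (s - q n s))) \<longlonglongrightarrow> indicator {a<..b} s * deriv_on a b h s"
    proof (cases "s \<in> {a<..b}")
      case True
      then have "(h has_field_derivative deriv_on a b h s) (at s within {a..b})"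
        using diff[OF True] unfolding deriv_on_def
        by (simp add: has_real_derivative_iff_has_vector_derivative vector_derivative_works)
      then have lim: "((\<lambda>y. (h y - h s) / (y - s)) \<longlongrightarrow> deriv_on a b h s) (at s within {a..b})"
        by (simp add: has_field_derivative_iff)
      have "(\<lambda>n. q n s) \<longlonglongrightarrow> s"
        unfolding q_def by real_asymp
      moreover have "\<forall>n. q n s \<in> {a..b} \<and> q n s \<noteq> s"
      proof
        fix n show "q n s \<in> {a..b} \<and> q n s \<noteq> s" using q_in[OF True, of n] by auto
      qed
      ultimately have "filterlim (\<lambda>n. q n s) (at s within {a..b}) sequentially"
        by (simp add: filterlim_at)
      from filterlim_compose[OF lim this] have "(\<lambda>n. (h (q n s) - h s) / (q n s - s)) \<longlonglongrightarrow> deriv_on a b h s" .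
      then show ?thesis using True
        by (simp add: minus_divide_divide[of "h s - _", symmetric])
    qed simp
  qed
qed

text \<open>Comparing the equation at t and t0, the variation of F reappears on the right with
  factor q < 1 and is absorbed. What remains is the variation of f along the continuous u with its
  last argument frozen at F t0.\<close>

lemma continuous_on_implicit:
  fixes f :: "real \<Rightarrow> real \<Rightarrow> real \<Rightarrow> real"
  assumes f: "continuous_on (T \<times> UNIV \<times> UNIV) (\<lambda>(t, x, y). f t x y)" and S: "S \<subseteq> T"
    and u: "continuous_on S u"
    and F: "\<And>t. t \<in> S \<Longrightarrow> F t = f t (u t) (F t)"
    and lip: "\<And>t x v w. t \<in> S \<Longrightarrow> \<bar>f t x v - f t x w\<bar> \<le> q * \<bar>v - w\<bar>" and q: "q < 1"
  shows "continuous_on S F"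
  unfolding continuous_on_def
proof
  fix t0 assume t0: "t0 \<in> S"
  let ?e = "\<lambda>t. \<bar>f t (u t) (F t0) - f t0 (u t0) (F t0)\<bar>"
  have "continuous_on S (\<lambda>t. (\<lambda>(t, x, y). f t x y) (t, u t, F t0))"
    by (rule continuous_on_compose2[OF f continuous_on_Pair[OF continuous_on_id continuous_on_Pair[OF u continuous_on_const]]])
      (use S in auto)
  then have "((\<lambda>t. f t (u t) (F t0)) \<longlongrightarrow> f t0 (u t0) (F t0)) (at t0 within S)"
    using t0 unfolding continuous_on_def by simp
  then have "((\<lambda>t. \<bar>f t (u t) (F t0) - f t0 (u t0) (F t0)\<bar> / (1 - q)) \<longlongrightarrow> \<bar>f t0 (u t0) (F t0) - f t0 (u t0) (F t0)\<bar> / (1 - q)) (at t0 within S)"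
    using q by (intro tendsto_intros) auto
  then have lim: "((\<lambda>t. ?e t / (1 - q)) \<longlongrightarrow> 0) (at t0 within S)" by simp
  have "\<bar>F t - F t0\<bar> \<le> ?e t / (1 - q)" if "t \<in> S" for t
  proof -
    have "\<bar>F t - F t0\<bar> \<le> q * \<bar>F t - F t0\<bar> + ?e t"
      using lip[OF that, of "u t" "F t" "F t0"] F[OF that] F[OF t0] by linarith
    then show ?thesis using q by (simp add: pos_le_divide_eq algebra_simps)
  qed
  then have "\<forall>\<^sub>F t in at t0 within S. norm (F t - F t0) \<le> ?e t / (1 - q)"
    by (auto simp: eventually_at_filter)
  then show "(F \<longlongrightarrow> F t0) (at t0 within S)"
    by (subst Lim_null) (rule Lim_null_comparison[OF _ lim])
qed

section \<open>The scale as a change of variables\<close>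

locale psi_scale =
  fixes a b :: real and \<psi> :: "real \<Rightarrow> real"
  assumes ab: "a < b"
    and cont: "continuous_on {a..b} \<psi>"
    and incr: "strict_mono_on {a..b} \<psi>"
    and diff: "\<And>t. t \<in> {a..b} \<Longrightarrow> \<psi> differentiable (at t within {a..b})"
    and deriv_nz: "\<And>t. t \<in> {a..b} \<Longrightarrow> deriv_on a b \<psi> t \<noteq> 0"
begin

abbreviation X :: "real \<Rightarrow> real" where "X t \<equiv> \<psi> t - \<psi> a"

abbreviation L :: real where "L \<equiv> X b"

abbreviation d\<psi> :: "real \<Rightarrow> real" where "d\<psi> \<equiv> deriv_on a b \<psi>"

definition \<phi> :: "real \<Rightarrow> real" where "\<phi> = inv_into {a..b} X"

text \<open>The function h in the new variable. Extension by 0 makes it a function on the whole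
  line, so that Borel measurability can be stated without restricting the space.\<close>

definition pull :: "(real \<Rightarrow> real) \<Rightarrow> real \<Rightarrow> real" where
  "pull h x = (if x \<in> {0<..L} then h (\<phi> x) else 0)"

lemma X_mono: "s \<in> {a..b} \<Longrightarrow> t \<in> {a..b} \<Longrightarrow> X s < X t \<longleftrightarrow> s < t"
  using strict_mono_on_less[OF incr] by simp

lemma X_mono_le: "s \<in> {a..b} \<Longrightarrow> t \<in> {a..b} \<Longrightarrow> X s \<le> X t \<longleftrightarrow> s \<le> t"
  using strict_mono_on_less_eq[OF incr] by simp

lemma X_in: "t \<in> {a<..b} \<Longrightarrow> X t \<in> {0<..L}"
  using X_mono[of a t] X_mono_le[of t b] ab by simp

lemma inj_X: "inj_on X {a..b}"
  using strict_mono_on_imp_inj_on[OF incr] by (auto simp: inj_on_def)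

lemma cont_X: "continuous_on {a..b} X"
  by (intro continuous_intros cont)

lemma image_X: "X ` {a..b} = {0..L}"
proof (intro equalityI subsetI)
  fix x assume "x \<in> {0..L}"
  then show "x \<in> X ` {a..b}"
    using IVT'[of X a x b] cont_X ab by force
qed (use X_mono_le[of a] X_mono_le[of _ b] ab in force)

lemma \<phi>_X: "t \<in> {a..b} \<Longrightarrow> \<phi> (X t) = t"
  unfolding \<phi>_def by (rule inv_into_f_f[OF inj_X])

lemma X_\<phi>: "x \<in> {0..L} \<Longrightarrow> X (\<phi> x) = x" and \<phi>_in: "x \<in> {0..L} \<Longrightarrow> \<phi> x \<in> {a..b}"
  unfolding \<phi>_def using image_X f_inv_into_f[of x X "{a..b}"] inv_into_into[of x X "{a..b}"] by auto

lemma \<phi>_in': "x \<in> {0<..L} \<Longrightarrow> \<phi> x \<in> {a<..b}"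
  using X_\<phi>[of x] \<phi>_in[of x] by (cases "\<phi> x = a") auto

lemma image_X_Ioo: "t \<in> {a..b} \<Longrightarrow> X ` {a<..<t} = {0<..<X t}"
proof (intro equalityI subsetI)
  fix x assume t: "t \<in> {a..b}" and x: "x \<in> {0<..<X t}"
  then have "x \<in> {0..L}" using X_mono_le[of t b] by auto
  then have "x = X (\<phi> x)" "\<phi> x \<in> {a..b}" using X_\<phi> \<phi>_in by auto
  then show "x \<in> X ` {a<..<t}"
    using x t X_mono[of a "\<phi> x"] X_mono[of "\<phi> x" t] by (intro image_eqI[of _ _ "\<phi> x"]) auto
qed (use X_mono[of a] X_mono[of _ t] in force)

lemma cont_\<phi>: "continuous_on {0..L} \<phi>"
  using continuous_on_inv[OF cont_X compact_Icc, of \<phi>] \<phi>_X unfolding image_X by blast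

lemma pull_X: "t \<in> {a<..b} \<Longrightarrow> pull h (X t) = h t"
  using X_in \<phi>_X by (simp add: pull_def)

lemma borel_pull:
  assumes "(\<lambda>s. indicator {a<..b} s * h s) \<in> borel_measurable borel"
  shows "pull h \<in> borel_measurable borel"
proof -
  have "(\<lambda>x. indicator {0..L} x *\<^sub>R \<phi> x) \<in> borel_measurable borel"
    by (intro borel_measurable_continuous_on_indicator cont_\<phi>) auto
  from measurable_compose[OF this assms]
  have "(\<lambda>x. indicator {0<..L} x * (indicator {a<..b} (indicator {0..L} x *\<^sub>R \<phi> x) * h (indicator {0..L} x *\<^sub>R \<phi> x))) \<in> borel_measurable borel"
    by measurable
  also have "(\<lambda>x. indicator {0<..L} x * (indicator {a<..b} (indicator {0..L} x *\<^sub>R \<phi> x) * h (indicator {0..L} x *\<^sub>R \<phi> x))) = pull h"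
    using \<phi>_in' by (auto simp: fun_eq_iff pull_def indicator_def)
  finally show ?thesis .
qed

lemma borel_pull_continuous:
  assumes "continuous_on {a<..b} h"
  shows "pull h \<in> borel_measurable borel"
  using borel_measurable_continuous_on_indicator[OF _ assms] by (intro borel_pull) simp

lemma continuous_pull:
  assumes "continuous_on {a<..b} h"
  shows "continuous_on {0<..L} (pull h)"
proof -
  have "continuous_on {0<..L} (\<lambda>x. h (\<phi> x))"
    using \<phi>_in' by (intro continuous_on_compose2[OF assms] continuous_on_subset[OF cont_\<phi>]) auto
  then show ?thesis by (rule continuous_on_eq) (simp add: pull_def)
qed

lemma deriv_X: "s \<in> {a..b} \<Longrightarrow> (X has_real_derivative d\<psi> s) (at s within {a..b})"
  using diff[of s] unfolding deriv_on_def
  by (auto intro!: derivative_eq_intros simp: has_real_derivative_iff_has_vector_derivative vector_derivative_works)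

text \<open>Difference quotients of an increasing function are nonnegative, so the nonzero
  derivative is positive; this removes the absolute value from the Jacobian.\<close>

lemma d\<psi>_pos:
  assumes "s \<in> {a..b}" shows "0 < d\<psi> s"
proof -
  have "0 \<le> d\<psi> s"
  proof (rule tendsto_lowerbound)
    show "((\<lambda>y. (X y - X s) / (y - s)) \<longlongrightarrow> d\<psi> s) (at s within {a..b})"
      using deriv_X[OF assms] by (simp add: has_field_derivative_iff)
    have "0 \<le> (X y - X s) / (y - s)" if "y \<in> {a..b}" for y
      using X_mono_le[OF assms that] X_mono_le[OF that assms] by (simp add: zero_le_divide_iff) linarith
    then show "\<forall>\<^sub>F y in at s within {a..b}. 0 \<le> (X y - X s) / (y - s)"
      by (auto simp: eventually_at_filter)
    show "at s within {a..b} \<noteq> bot"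
      using assms ab by (simp add: trivial_limit_within islimpt_Icc)
  qed
  then show ?thesis using deriv_nz[OF assms] by simp
qed

lemma borel_d\<psi>: "(\<lambda>s. indicator {a<..b} s * d\<psi> s) \<in> borel_measurable borel"
  using diff by (intro borel_measurable_deriv_on) auto

text \<open>\<open>X\<close> is injective and differentiable with derivative \<open>d\<psi>\<close>,
  so absolute integrability and the value of the integral transfer together, and Borel measurability
  brings both to \<open>lborel\<close>. If one side is not integrable then neither is the other, and
  both integrals are 0 by convention, so the equation is unconditional.\<close>

lemma substitution:
  assumes t: "t \<in> {a<..b}" and K[measurable]: "K \<in> borel_measurable borel"
    and g: "\<And>s. s \<in> {a<..<t} \<Longrightarrow> g s = d\<psi> s * K (X s)"
  shows "set_integrable lborel {a..t} g \<longleftrightarrow> set_integrable lborel {0<..<X t} K"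
    and "(LBINT s:{a..t}. g s) = (LBINT y:{0<..<X t}. K y)"
proof -
  let ?g = "\<lambda>s. d\<psi> s * K (X s)"
  have "(\<lambda>s. indicator {a..b} s *\<^sub>R X s) \<in> borel_measurable borel"
    by (intro borel_measurable_continuous_on_indicator cont_X) auto
  then have [measurable]: "(\<lambda>s. indicator {a<..<t} s * ((indicator {a<..b} s * d\<psi> s) * K (indicator {a..b} s *\<^sub>R X s))) \<in> borel_measurable borel"
    using borel_d\<psi> by measurable
  also have "(\<lambda>s. indicator {a<..<t} s * ((indicator {a<..b} s * d\<psi> s) * K (indicator {a..b} s *\<^sub>R X s))) = (\<lambda>s. indicator {a<..<t} s *\<^sub>R ?g s)"
    using t by (auto simp: fun_eq_iff indicator_def)
  finally have m1: "(\<lambda>s. indicator {a<..<t} s *\<^sub>R ?g s) \<in> borel_measurable lborel" by simp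
  have m2: "(\<lambda>y. indicator {0<..<X t} y *\<^sub>R K y) \<in> borel_measurable lborel" by measurable
  have sub: "{a<..<t} \<subseteq> {a..b}" using t by auto
  have der: "(X has_field_derivative d\<psi> s) (at s within {a<..<t})" if "s \<in> {a<..<t}" for s
    by (rule has_field_derivative_subset[OF deriv_X sub]) (use that sub in auto)
  have "(\<lambda>s. \<bar>d\<psi> s\<bar> * K (X s)) absolutely_integrable_on {a<..<t} \<and> integral {a<..<t} (\<lambda>s. \<bar>d\<psi> s\<bar> * K (X s)) = r
      \<longleftrightarrow> K absolutely_integrable_on X ` {a<..<t} \<and> integral (X ` {a<..<t}) K = r" for r
    by (rule has_absolute_integral_change_of_variables_1'[OF _ der inj_on_subset[OF inj_X sub]]) auto
  moreover have "(\<lambda>s. \<bar>d\<psi> s\<bar> * K (X s)) absolutely_integrable_on {a<..<t} \<longleftrightarrow> ?g absolutely_integrable_on {a<..<t}"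
    using d\<psi>_pos sub by (intro set_integrable_cong) (auto simp: subset_iff abs_of_pos)
  moreover have "integral {a<..<t} (\<lambda>s. \<bar>d\<psi> s\<bar> * K (X s)) = integral {a<..<t} ?g"
    using d\<psi>_pos sub by (intro Henstock_Kurzweil_Integration.integral_cong) (auto simp: subset_iff abs_of_pos)
  ultimately have cov: "?g absolutely_integrable_on {a<..<t} \<and> integral {a<..<t} ?g = r
      \<longleftrightarrow> K absolutely_integrable_on {0<..<X t} \<and> integral {0<..<X t} K = r" for r
    using image_X_Ioo[of t] t by auto
  have c1: "?g absolutely_integrable_on {a<..<t} \<longleftrightarrow> set_integrable lborel {a<..<t} ?g"
    unfolding set_integrable_def using integrable_completion[OF m1] by simp
  have c2: "K absolutely_integrable_on {0<..<X t} \<longleftrightarrow> set_integrable lborel {0<..<X t} K"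
    unfolding set_integrable_def using integrable_completion[OF m2] by simp
  have iff: "set_integrable lborel {a<..<t} ?g \<longleftrightarrow> set_integrable lborel {0<..<X t} K"
    using cov c1 c2 by blast
  have eq: "(LBINT s:{a<..<t}. ?g s) = (LBINT y:{0<..<X t}. K y)"
  proof (cases "set_integrable lborel {0<..<X t} K")
    case True
    then have g_int: "set_integrable lborel {a<..<t} ?g" using iff by simp
    have "integral {a<..<t} ?g = integral {0<..<X t} K"
      using cov[of "integral {0<..<X t} K"] True c2 by simp
    then show ?thesis
      unfolding set_borel_integral_eq_integral(2)[OF True] set_borel_integral_eq_integral(2)[OF g_int] .
  next
    case False
    then have "\<not> set_integrable lborel {a<..<t} ?g" using iff by simp
    then show ?thesis using False
      by (simp add: set_lebesgue_integral_def set_integrable_def not_integrable_integral_eq)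
  qed
  have "set_integrable lborel {a..t} g \<longleftrightarrow> set_integrable lborel {a<..<t} g"
    using t by (intro set_integrable_discrete_difference[of "{a, t}"]) auto
  also have "\<dots> \<longleftrightarrow> set_integrable lborel {a<..<t} ?g"
    by (intro set_integrable_cong g) auto
  finally show "set_integrable lborel {a..t} g \<longleftrightarrow> set_integrable lborel {0<..<X t} K"
    using iff by simp
  have "(LBINT s:{a..t}. g s) = (LBINT s:{a<..<t}. g s)"
    using t by (intro set_integral_discrete_difference[of "{a, t}"]) auto
  also have "\<dots> = (LBINT s:{a<..<t}. ?g s)"
    using g by (intro set_lebesgue_integral_cong) auto
  finally show "(LBINT s:{a..t}. g s) = (LBINT y:{0<..<X t}. K y)"
    using eq by simp
qed

lemma psi_int_eq_rl:
  assumes t: "t \<in> {a<..b}" and [measurable]: "pull h \<in> borel_measurable borel"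
  shows "psi_int a b \<psi> \<mu> h t = rl \<mu> (pull h) (X t)"
    and "\<mu> \<noteq> 0 \<Longrightarrow> psi_int_exists a b \<psi> \<mu> h t \<longleftrightarrow> rl_exists \<mu> (pull h) (X t)"
proof -
  let ?K = "\<lambda>y. (X t - y) powr (\<mu> - 1) * pull h y"
  have [measurable]: "?K \<in> borel_measurable borel" by measurable
  have g: "psi_kernel_fun a b \<psi> \<mu> h t s = d\<psi> s * ?K (X s)" if "s \<in> {a<..<t}" for s
    using that t pull_X[of s h] by (simp add: psi_kernel_fun_def)
  show "psi_int a b \<psi> \<mu> h t = rl \<mu> (pull h) (X t)"
    using substitution(2)[OF t _ g] pull_X[OF t] by (simp add: psi_int_def rl_def)
  show "psi_int_exists a b \<psi> \<mu> h t \<longleftrightarrow> rl_exists \<mu> (pull h) (X t)" if "\<mu> \<noteq> 0"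
    using substitution(1)[OF t _ g] that by (simp add: psi_int_exists_def)
qed

text \<open>w is differentiable only on (a,b], so the fundamental theorem is applied on [r,t] and r
  is sent to a. Integrability of the derivative gives convergence of the integrals, and the limit c
  takes the place of an initial value. The factor 1 / \<psi>' cancels against the Jacobian.\<close>

lemma integral_psi_deriv:
  assumes diff_w: "\<And>s. s \<in> {a<..b} \<Longrightarrow> w differentiable (at s within {a..b})"
    and lim: "(w \<longlongrightarrow> c) (at_right a)"
    and [measurable]: "pull (psi_deriv a b \<psi> w) \<in> borel_measurable borel"
    and int: "set_integrable lborel {0<..<L} (pull (psi_deriv a b \<psi> w))"
    and t: "t \<in> {a<..b}"
  shows "w t = c + (LBINT y:{0<..<X t}. pull (psi_deriv a b \<psi> w) y)"
proof -
  let ?G = "pull (psi_deriv a b \<psi> w)" and ?w' = "deriv_on a b w"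
  have "?w' s = d\<psi> s * ?G (X s)" if "s \<in> {a<..<t}" for s
    using that t pull_X[of s] deriv_nz[of s] by (simp add: psi_deriv_def)
  note subst = substitution[OF t _ this]
  have "set_integrable lborel {0<..<X t} ?G"
    by (rule set_integrable_subset[OF int]) (use X_in[OF t] in auto)
  then have "set_integrable lborel {a..t} ?w'"
    using subst(1) by simp
  note hk = set_borel_integral_eq_integral[OF this]
  have "continuous_on {a..t} (\<lambda>r. integral {r..t} ?w')"
    by (rule indefinite_integral_continuous_1'[OF hk(1)])
  then have "((\<lambda>r. integral {r..t} ?w') \<longlongrightarrow> integral {a..t} ?w') (at a within {a..t})"
    using t by (simp add: continuous_on_def)
  then have lim1: "((\<lambda>r. integral {r..t} ?w') \<longlongrightarrow> integral {a..t} ?w') (at_right a)"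
    using t by (simp add: at_within_Icc_at_right)
  have "integral {r..t} ?w' = w t - w r" if r: "r \<in> {a<..<t}" for r
  proof (rule integral_unique, rule fundamental_theorem_of_calculus)
    fix s assume s: "s \<in> {r..t}"
    then have "(w has_vector_derivative ?w' s) (at s within {a..b})"
      using diff_w[of s] r t by (simp add: deriv_on_def vector_derivative_works)
    then show "(w has_vector_derivative ?w' s) (at s within {r..t})"
      by (rule has_vector_derivative_within_subset) (use r t in auto)
  qed (use r in auto)
  moreover have "\<forall>\<^sub>F r in at_right a. r \<in> {a<..<t}"
    using t eventually_at_right_field by fastforce
  ultimately have "\<forall>\<^sub>F r in at_right a. integral {r..t} ?w' = w t - w r"
    by (auto elim: eventually_mono)
  with lim1 have "((\<lambda>r. w t - w r) \<longlongrightarrow> integral {a..t} ?w') (at_right a)"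
    by (rule Lim_transform_eventually)
  moreover have "((\<lambda>r. w t - w r) \<longlongrightarrow> w t - c) (at_right a)"
    by (intro tendsto_intros lim)
  ultimately have "integral {a..t} ?w' = w t - c"
    by (intro tendsto_unique[OF trivial_limit_at_right_real])
  then show ?thesis using hk(2) subst(2) by simp
qed

section \<open>Weighted spaces and the Volterra equation for solutions\<close>

lemma C_weighted_bound:
  assumes "u \<in> C_weighted a b \<psi> r"
  shows "continuous_on {a<..b} u"
    and "\<exists>C. \<forall>t\<in>{a<..b}. \<bar>u t\<bar> \<le> C * X t powr (- r)"
proof -
  let ?w = "psi_weighted a \<psi> r u"
  have w: "continuous_on {a..b} ?w" using assms by (simp add: C_weighted_def)
  have u: "u t = X t powr (- r) * ?w t" if "t \<in> {a<..b}" for t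
    using that X_in[OF that] by (simp add: psi_weighted_def powr_minus)
  have "continuous_on {a<..b} (\<lambda>t. X t powr (- r) * ?w t)"
    using X_in by (intro continuous_intros continuous_on_subset[OF w] continuous_on_subset[OF cont]) fastforce+
  then show "continuous_on {a<..b} u"
    by (rule continuous_on_eq) (simp add: u)
  obtain C where "\<forall>y\<in>?w ` {a..b}. norm y \<le> C"
    using compact_imp_bounded[OF compact_continuous_image[OF w compact_Icc]] unfolding bounded_iff by blast
  then have C: "\<bar>?w t\<bar> \<le> C" if "t \<in> {a..b}" for t
    using that by simp
  show "\<exists>C. \<forall>t\<in>{a<..b}. \<bar>u t\<bar> \<le> C * X t powr (- r)"
  proof (intro exI ballI)
    fix t assume t: "t \<in> {a<..b}"
    show "\<bar>u t\<bar> \<le> C * X t powr (- r)"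
      unfolding u[OF t] abs_mult using C[of t] t by (simp add: mult.commute mult_right_mono)
  qed
qed

text \<open>The weight increases, so the supremum is attained at b. The norm of a constant is thus a
  fixed positive multiple of its modulus, and the weighted Lipschitz condition becomes the ordinary
  one after cancellation.\<close>

lemma norm_weighted_const:
  assumes r: "0 \<le> r"
  shows "norm_weighted a b \<psi> r (\<lambda>_. c) = L powr r * \<bar>c\<bar>"
proof -
  have L: "0 < L" using X_in[of b] ab by simp
  have in_range: "\<bar>psi_weighted a \<psi> r (\<lambda>_. c) t\<bar> \<le> L powr r * \<bar>c\<bar>" if t: "t \<in> {a..b}" for t
  proof (cases "t = a")
    case False
    then have "0 < X t" "X t \<le> L" using t X_in[of t] by auto
    then show ?thesis
      using False r by (auto simp: psi_weighted_def abs_mult intro!: mult_right_mono powr_mono2)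
  next
    case True
    have X0: "(X \<longlongrightarrow> 0) (at_right a)"
      using bspec[OF cont_X[unfolded continuous_on_def], of a] ab by (simp add: at_within_Icc_at_right)
    have near: "\<forall>\<^sub>F s in at_right a. s \<in> {a<..<b}"
      using ab eventually_at_right_field by fastforce
    \<comment> \<open>The value at a is a limit. It jumps at r = 0, where the weight is 1 on (a,b]
      although 0 powr 0 = 0, so that case is treated separately.\<close>
    have "((\<lambda>s. X s powr r * c) \<longlongrightarrow> (if r = 0 then c else 0)) (at_right a)"
    proof (cases "r = 0")
      case True
      have "\<forall>\<^sub>F s in at_right a. c = X s powr r * c"
        using near by eventually_elim (use X_in in \<open>force simp: True\<close>)
      then have "((\<lambda>s. X s powr r * c) \<longlongrightarrow> c) (at_right a)"
        by (rule Lim_transform_eventually[OF tendsto_const])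
      then show ?thesis using True by (simp only: simp_thms if_True)
    next
      case False
      have "((\<lambda>s. X s powr r) \<longlongrightarrow> 0 powr r) (at_right a)"
        by (rule tendsto_powr2[OF X0 tendsto_const])
          (use False r near X_in in \<open>auto elim!: eventually_mono simp: less_imp_le\<close>)
      from tendsto_mult[OF this tendsto_const[of c]] show ?thesis using False by simp
    qed
    then have "Lim (at_right a) (\<lambda>s. X s powr r * c) = (if r = 0 then c else 0)"
      by (rule tendsto_Lim[OF trivial_limit_at_right_real])
    then show ?thesis using True L by (simp add: psi_weighted_def)
  qed
  have "\<bar>psi_weighted a \<psi> r (\<lambda>_. c) b\<bar> = L powr r * \<bar>c\<bar>"
    using ab by (simp add: psi_weighted_def abs_mult)
  then show ?thesis
    unfolding norm_weighted_def using in_range ab by (intro cSup_eq_maximum) (auto intro!: image_eqI[of _ _ b])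
qed

text \<open>Translation into \<open>rl_cauchy_solution\<close>: w is the integral of order 1 -
  \<gamma> of u, g its derivative with respect to the scale, and F the integral of g of order \<mu>
  = \<gamma> - \<alpha>.\<close>

lemma hilfer_solution_volterra:
  assumes al: "0 < \<alpha>" "\<alpha> < 1" and be: "0 \<le> \<beta>" "\<beta> \<le> 1" and ga: "\<gamma> = \<alpha> + \<beta> - \<alpha> * \<beta>"
    and sol: "psi_hilfer_solution a b \<psi> f \<alpha> \<beta> \<gamma> c u"
    and F: "F = psi_hilfer a b \<psi> \<alpha> \<beta> u" and contF: "continuous_on {a<..b} F"
    and boundF: "\<And>t. t \<in> {a<..b} \<Longrightarrow> \<bar>F t\<bar> \<le> C * X t powr (\<gamma> - 1)"
    and t: "t \<in> {a<..b}"
  shows "u t = c * X t powr (\<gamma> - 1) / Gamma \<gamma> + rl \<alpha> (pull F) (X t)"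
proof -
  define \<mu> where "\<mu> = \<beta> * (1 - \<alpha>)"
  have mu: "0 \<le> \<mu>" "\<gamma> = \<alpha> + \<mu>" "\<mu> \<le> 1"
    unfolding \<mu>_def using al be mult_nonneg_nonneg[of \<beta> "1 - \<alpha>"] mult_le_one[of \<beta> "1 - \<alpha>"]
    by (simp_all add: ga) (simp add: right_diff_distrib)
  have ga1: "(1 - \<beta>) * (1 - \<alpha>) = 1 - \<gamma>" by (simp add: ga algebra_simps)
  have "0 \<le> (1 - \<beta>) * (1 - \<alpha>)" using al be by simp
  then have ga_le: "\<gamma> \<le> 1" unfolding ga1 by simp
  have ga0: "0 < \<gamma>" using mu al by simp
  define w where "w = psi_int a b \<psi> (1 - \<gamma>) u"
  define g where "g = psi_deriv a b \<psi> w"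
  have uC: "u \<in> C_weighted a b \<psi> (1 - \<gamma>)"
    and ex: "\<And>t. t \<in> {a<..b} \<Longrightarrow> psi_hilfer_exists a b \<psi> \<alpha> \<beta> u t"
    and lim: "(w \<longlongrightarrow> c) (at_right a)"
    using sol by (auto simp: psi_hilfer_solution_def w_def)
  obtain C' where "\<forall>t\<in>{a<..b}. \<bar>u t\<bar> \<le> C' * X t powr (\<gamma> - 1)"
    using C_weighted_bound(2)[OF uC] by auto
  then have C': "\<bar>u t\<bar> \<le> C' * X t powr (\<gamma> - 1)" if "t \<in> {a<..b}" for t
    using that by blast
  note contu = C_weighted_bound(1)[OF uC]
  have bb: "b \<in> {a<..b}" using ab by simp
  have diff_w: "w differentiable (at s within {a..b})" if "s \<in> {a<..b}" for s
    using ex[OF bb] that unfolding psi_hilfer_exists_def ga1 w_def by simp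
  have exg: "psi_int_exists a b \<psi> \<mu> g s" if "s \<in> {a<..b}" for s
    using ex[OF that] unfolding psi_hilfer_exists_def ga1 w_def g_def \<mu>_def by simp
  \<comment> \<open>Outside (a,b] numerator and denominator both vanish, and 0 / 0 = 0, so this
    quotient of measurable functions is the restriction of g.\<close>
  have "(\<lambda>s. (indicator {a<..b} s * deriv_on a b w s) / (indicator {a<..b} s * d\<psi> s)) \<in> borel_measurable borel"
    by (intro borel_measurable_divide borel_d\<psi> borel_measurable_deriv_on diff_w)
  also have "(\<lambda>s. (indicator {a<..b} s * deriv_on a b w s) / (indicator {a<..b} s * d\<psi> s)) = (\<lambda>s. indicator {a<..b} s * g s)"
    by (auto simp: fun_eq_iff g_def psi_deriv_def indicator_def)
  finally have mg[measurable]: "pull g \<in> borel_measurable borel"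
    by (rule borel_pull)
  have mpull[measurable]: "pull u \<in> borel_measurable borel" "pull F \<in> borel_measurable borel"
    by (intro borel_pull_continuous contu contF)+
  have Fg: "F s = rl \<mu> (pull g) (X s)" if "s \<in> {a<..b}" for s
    using psi_int_eq_rl(1)[OF that mg, of \<mu>] unfolding F psi_hilfer_def ga1 w_def g_def \<mu>_def by simp
  have pull_bound: "\<bar>pull h y\<bar> \<le> B * y powr (\<gamma> - 1)"
    if "\<And>t. t \<in> {a<..b} \<Longrightarrow> \<bar>h t\<bar> \<le> B * X t powr (\<gamma> - 1)" "y \<in> {0<..L}" for h B y
    using that(1)[OF \<phi>_in'[OF that(2)]] X_\<phi>[of y] that(2) by (simp add: pull_def)
  have pull_rl: "pull h y = rl p k y" if "\<And>s. s \<in> {a<..b} \<Longrightarrow> h s = rl p k (X s)" "y \<in> {0<..L}" for h p k y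
    using that(1)[OF \<phi>_in'[OF that(2)]] X_\<phi>[of y] that(2) by (simp add: pull_def)
  \<comment> \<open>For \<mu> > 0, existence of the Hilfer derivative at b gives integrability
    against a kernel of order at most 1. For \<mu> = 0 existence carries no information, but then g
    coincides with F on (a,b] and inherits its growth bound.\<close>
  have int_g: "set_integrable lborel {0<..<L} (pull g)"
  proof (cases "\<mu> = 0")
    case False
    then show ?thesis
      using exg[OF bb] psi_int_eq_rl(2)[OF bb mg, of \<mu>] rl_exists_imp_set_integrable[OF mu(3) mg, of L] by simp
  next
    case True
    then have "\<bar>pull g y\<bar> \<le> C * y powr (\<gamma> - 1)" if "y \<in> {0<..L}" for y
      using pull_rl[OF Fg that] pull_bound[OF boundF that] by simp
    then have "rl_exists 1 (pull g) L"
      by (intro rl_exists_powr_bounded[OF _ ga0, where C = C]) auto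
    then show ?thesis unfolding rl_exists_1 .
  qed
  have w_eq: "rl (1 - \<gamma>) (pull u) y = c + (LBINT z:{0<..<y}. pull g z)" if y: "y \<in> {0<..L}" for y
    using integral_psi_deriv[OF diff_w lim _ _ \<phi>_in'[OF y]] int_g X_\<phi>[of y] y
      psi_int_eq_rl(1)[OF \<phi>_in'[OF y] mpull(1), of "1 - \<gamma>"] by (simp flip: g_def w_def)
  have "pull u (X t) = c * X t powr (\<gamma> - 1) / Gamma \<gamma> + rl \<alpha> (pull F) (X t)"
    by (rule rl_cauchy_solution[OF al(1) mu(1,2) ga_le _ _ _ continuous_pull[OF contu] continuous_pull[OF contF]
        pull_bound[OF C'] pull_bound[OF boundF] int_g pull_rl[OF Fg] w_eq X_in[OF t]]) measurable
  then show ?thesis using pull_X[OF t] by simp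
qed

section \<open>Growth classes at the left end point\<close>

text \<open>The exponent is shifted by 1 so that d > 0 is the integrability condition at a; members
  of the weighted space of order 1 - \<gamma> are dominated with d = \<gamma>.\<close>

definition dominated :: "real \<Rightarrow> (real \<Rightarrow> real) \<Rightarrow> bool" where
  "dominated d h \<longleftrightarrow> (\<exists>C. \<forall>t\<in>{a<..b}. \<bar>h t\<bar> \<le> C * X t powr (d - 1))"

lemma dominated_powr:
  assumes "d - 1 \<le> e" shows "dominated d (\<lambda>t. X t powr e)"
  unfolding dominated_def
proof (intro exI ballI)
  fix t assume "t \<in> {a<..b}"
  then have "0 < X t" "X t \<le> L" using X_in by auto
  then have "X t powr (e - (d - 1)) * X t powr (d - 1) \<le> L powr (e - (d - 1)) * X t powr (d - 1)"
    using assms by (intro mult_right_mono powr_mono2) auto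
  then show "\<bar>X t powr e\<bar> \<le> L powr (e - (d - 1)) * X t powr (d - 1)"
    by (simp flip: powr_add)
qed

lemma dominated_add:
  assumes "dominated d h" "dominated d k" shows "dominated d (\<lambda>t. h t + k t)"
proof -
  obtain C C' where "\<forall>t\<in>{a<..b}. \<bar>h t\<bar> \<le> C * X t powr (d - 1)" "\<forall>t\<in>{a<..b}. \<bar>k t\<bar> \<le> C' * X t powr (d - 1)"
    using assms unfolding dominated_def by blast
  then have "\<forall>t\<in>{a<..b}. \<bar>h t + k t\<bar> \<le> (C + C') * X t powr (d - 1)"
    unfolding distrib_right by (blast intro: order_trans[OF abs_triangle_ineq] add_mono)
  then show ?thesis unfolding dominated_def by blast
qed

lemma dominated_le:
  assumes "dominated d k" "\<And>t. t \<in> {a<..b} \<Longrightarrow> \<bar>h t\<bar> \<le> \<bar>k t\<bar>" shows "dominated d h"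
  using assms unfolding dominated_def by (blast intro: order_trans)

lemma dominated_cmult:
  assumes "dominated d h" shows "dominated d (\<lambda>t. c * h t)"
proof -
  obtain C where C: "\<forall>t\<in>{a<..b}. \<bar>h t\<bar> \<le> C * X t powr (d - 1)"
    using assms unfolding dominated_def by blast
  have "\<bar>c * h t\<bar> \<le> (\<bar>c\<bar> * C) * X t powr (d - 1)" if "t \<in> {a<..b}" for t
    unfolding abs_mult mult.assoc using C that by (intro mult_left_mono) auto
  then show ?thesis unfolding dominated_def by blast
qed

lemma dominated_divide: "dominated d h \<Longrightarrow> dominated d (\<lambda>t. h t / c)"
  using dominated_cmult[of d h "1 / c"] by simp

lemma dominated_abs: "dominated d h \<Longrightarrow> dominated d (\<lambda>t. \<bar>h t\<bar>)"
  by (simp add: dominated_def)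

lemma dominated_diff:
  assumes "dominated d h" "dominated d k" shows "dominated d (\<lambda>t. h t - k t)"
  using dominated_add[OF assms(1) dominated_cmult[OF assms(2), of "- 1"]] by simp

lemma dominated_mono:
  assumes "dominated e h" "d \<le> e" shows "dominated d h"
proof -
  obtain C where C: "\<forall>t\<in>{a<..b}. \<bar>h t\<bar> \<le> C * X t powr (e - 1)"
    using assms unfolding dominated_def by blast
  show ?thesis
  proof (rule dominated_le[OF dominated_cmult[OF dominated_powr]])
    show "\<bar>h t\<bar> \<le> \<bar>C * X t powr (e - 1)\<bar>" if "t \<in> {a<..b}" for t
      using C that by (intro order_trans[OF _ abs_ge_self]) auto
  qed (use assms in auto)
qed

lemma dominated_pull:
  assumes "dominated d h"
  shows "\<exists>C. \<forall>y\<in>{0<..L}. \<bar>pull h y\<bar> \<le> C * y powr (d - 1)"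
proof -
  obtain C where C: "\<forall>t\<in>{a<..b}. \<bar>h t\<bar> \<le> C * X t powr (d - 1)"
    using assms unfolding dominated_def by blast
  have "\<bar>pull h y\<bar> \<le> C * y powr (d - 1)" if "y \<in> {0<..L}" for y
    using C[rule_format, OF \<phi>_in'[OF that]] X_\<phi>[of y] that by (simp add: pull_def)
  then show ?thesis by blast
qed

lemma rl_exists_pull:
  assumes "0 < p" "0 < d" "dominated d h" "continuous_on {a<..b} h" "t \<in> {a<..b}"
  shows "rl_exists p (pull h) (X t)"
proof -
  obtain C where "\<forall>y\<in>{0<..L}. \<bar>pull h y\<bar> \<le> C * y powr (d - 1)"
    using dominated_pull[OF assms(3)] by blast
  then show ?thesis
    using X_in[OF assms(5)] by (intro rl_exists_powr_bounded[OF assms(1,2) borel_pull_continuous[OF assms(4)]]) auto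
qed

end

section \<open>Dependence on the order\<close>

theorem theorem4:
  fixes a b \<alpha> \<beta> \<gamma> \<epsilon> M Mstar ua ustara normf :: real
    and \<psi> u ustar Fu A :: "real \<Rightarrow> real"
    and f :: "real \<Rightarrow> real \<Rightarrow> real \<Rightarrow> real"
  assumes ab: "0 < a" "a < b"
    and psi_cont: "continuous_on {a..b} \<psi>"
    and psi_incr: "strict_mono_on {a..b} \<psi>"
    and psi_diff: "\<And>t. t \<in> {a..b} \<Longrightarrow> \<psi> differentiable (at t within {a..b})"
    and psi_deriv: "\<And>t. t \<in> {a..b} \<Longrightarrow> deriv_on a b \<psi> t \<noteq> 0"
    and f_cont: "continuous_on ({a..b} \<times> UNIV \<times> UNIV) (\<lambda>(t, x, y). f t x y)"
    and M: "M > 0" and Mstar: "Mstar < 1"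
    and lipschitz: "\<And>t u1 u2 v1 v2. t \<in> {a<..b} \<Longrightarrow>
      norm_weighted a b \<psi> (1 - \<gamma>) (\<lambda>_. f t u1 v1 - f t u2 v2)
        \<le> M * norm_weighted a b \<psi> (1 - \<gamma>) (\<lambda>_. u1 - u2)
          + Mstar * norm_weighted a b \<psi> (1 - \<gamma>) (\<lambda>_. v1 - v2)"
    and alpha: "0 < \<alpha>" "\<alpha> < 1"
    and eps: "0 < \<epsilon>" "0 < \<alpha> - \<epsilon>"
    and beta: "0 \<le> \<beta>" "\<beta> \<le> 1"
    and gamma: "\<gamma> = \<alpha> + \<beta> - \<alpha> * \<beta>"
    and u_sol: "psi_hilfer_solution a b \<psi> f \<alpha> \<beta> \<gamma> ua u"
    and ustar_sol: "psi_hilfer_solution a b \<psi> f (\<alpha> - \<epsilon>) \<beta> (\<gamma> + \<epsilon> * (\<beta> - 1)) ustara ustar"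
    and Fu: "Fu = psi_hilfer a b \<psi> \<alpha> \<beta> u"
    and normf_finite: "bdd_above ((\<lambda>t. \<bar>f t (u t) (Fu t)\<bar>) ` {a<..b})"
    and normf: "normf = (SUP t\<in>{a<..b}. \<bar>f t (u t) (Fu t)\<bar>)"
    and A: "\<And>t. A t =
        \<bar>ustara * (\<psi> t - \<psi> a) powr (\<gamma> + \<epsilon> * (\<beta> - 1) - 1) / Gamma (\<gamma> + \<epsilon> * (\<beta> - 1))
          - ua * (\<psi> t - \<psi> a) powr (\<gamma> - 1) / Gamma \<gamma>\<bar>
        + normf * \<bar>(\<psi> t - \<psi> a) powr (\<alpha> - \<epsilon>) / Gamma (\<alpha> - \<epsilon> + 1)
          - (\<psi> t - \<psi> a) powr (\<alpha> - \<epsilon>) / (Gamma (\<alpha> - \<epsilon>) * Gamma \<alpha>)\<bar>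
        + normf * \<bar>(\<psi> t - \<psi> a) powr (\<alpha> - \<epsilon>) / (Gamma (\<alpha> - \<epsilon>) * Gamma \<alpha>)
          - (\<psi> t - \<psi> a) powr \<alpha> / Gamma (\<alpha> + 1)\<bar>"
  shows "\<forall>t\<in>{a<..b}.
    \<bar>ustar t - u t\<bar> \<le> A t +
      (LBINT s:{a..t}. (\<Sum>n. let k = Suc n in
         (M * Gamma (\<alpha> - \<epsilon>) / (Gamma \<alpha> * (1 - Mstar))) ^ k
         * (deriv_on a b \<psi> s * (\<psi> t - \<psi> s) powr (real k * (\<alpha> - \<epsilon>) - 1)
            / Gamma (real k * (\<alpha> - \<epsilon>)) * A s)))"

proof -
  interpret psi_scale a b \<psi>
    by unfold_locales (use ab psi_cont psi_incr psi_diff psi_deriv in auto)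
  define \<nu> where "\<nu> = \<alpha> - \<epsilon>"
  define \<gamma>' where "\<gamma>' = \<gamma> + \<epsilon> * (\<beta> - 1)"
  have nu: "0 < \<nu>" "\<nu> < \<alpha>" "\<nu> < 1" using alpha eps by (auto simp: \<nu>_def)
  have ga': "\<gamma>' = \<nu> + \<beta> - \<nu> * \<beta>" by (simp add: \<gamma>'_def \<nu>_def gamma algebra_simps)
  \<comment> \<open>These products are 1 - \<gamma>, \<gamma>' - \<nu> and \<gamma> - \<gamma>'
    respectively.\<close>
  have "0 \<le> (1 - \<beta>) * (1 - \<alpha>)" "0 \<le> \<beta> * (1 - \<nu>)" "0 \<le> \<epsilon> * (1 - \<beta>)" using alpha beta eps nu by auto
  then have ga_le: "\<gamma> \<le> 1" and ga'_pos: "0 < \<gamma>'" and ga'_le: "\<gamma> + \<epsilon> * (\<beta> - 1) \<le> \<gamma>"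
    using nu by (auto simp: gamma ga' algebra_simps)
  note ga'_le = ga'_le[folded \<gamma>'_def]
  define Fs where "Fs = psi_hilfer a b \<psi> \<nu> \<beta> ustar"
  have L: "0 < L" using X_in[of b] ab by simp
  have lip: "\<bar>f t x v - f t y w\<bar> \<le> M * \<bar>x - y\<bar> + Mstar * \<bar>v - w\<bar>" if "t \<in> {a<..b}" for t x y v w
  proof -
    have "L powr (1 - \<gamma>) * \<bar>f t x v - f t y w\<bar> \<le> M * (L powr (1 - \<gamma>) * \<bar>x - y\<bar>) + Mstar * (L powr (1 - \<gamma>) * \<bar>v - w\<bar>)"
      using lipschitz[OF that, of x v y w] ga_le by (simp add: norm_weighted_const)
    also have "\<dots> = L powr (1 - \<gamma>) * (M * \<bar>x - y\<bar> + Mstar * \<bar>v - w\<bar>)"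
      by (simp only: distrib_left mult_ac)
    finally show ?thesis using L by simp
  qed
  have Fu_eq: "Fu t = f t (u t) (Fu t)" if "t \<in> {a<..b}" for t
    using u_sol that by (simp add: psi_hilfer_solution_def Fu)
  have Fs_eq: "Fs t = f t (ustar t) (Fs t)" if "t \<in> {a<..b}" for t
    using ustar_sol that by (simp add: psi_hilfer_solution_def Fs_def flip: \<nu>_def)
  have uC: "u \<in> C_weighted a b \<psi> (1 - \<gamma>)" and sC: "ustar \<in> C_weighted a b \<psi> (1 - \<gamma>')"
    using u_sol ustar_sol by (auto simp: psi_hilfer_solution_def \<gamma>'_def)
  note contu = C_weighted_bound(1)[OF uC] and conts = C_weighted_bound(1)[OF sC]
  \<comment> \<open>The two solutions live in different weighted spaces; the smaller exponent
    \<gamma>' serves for both.\<close>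
  have domu: "dominated \<gamma>' u"
    using C_weighted_bound(2)[OF uC] by (intro dominated_mono[OF _ ga'_le]) (simp add: dominated_def)
  have doms: "dominated \<gamma>' ustar"
    using C_weighted_bound(2)[OF sC] by (simp add: dominated_def)
  have lip': "\<bar>f t x v - f t x w\<bar> \<le> Mstar * \<bar>v - w\<bar>" if "t \<in> {a<..b}" for t x v w
    using lip[OF that, of x v x w] by simp
  have sub: "{a<..b} \<subseteq> {a..b}" by auto
  \<comment> \<open>The solution concept does not include continuity of the fractional derivative;
    it follows from the equation, which is Lipschitz in that argument with constant
    \<open>Mstar\<close> < 1.\<close>
  have contFu: "continuous_on {a<..b} Fu"
    by (rule continuous_on_implicit[OF f_cont sub contu Fu_eq lip' Mstar])
  have contFs: "continuous_on {a<..b} Fs"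
    by (rule continuous_on_implicit[OF f_cont sub conts Fs_eq lip' Mstar])
  have Fu_le: "\<bar>Fu t\<bar> \<le> normf" if "t \<in> {a<..b}" for t
    using cSUP_upper[OF that normf_finite] Fu_eq[OF that] by (simp add: normf)
  have normf0: "0 \<le> normf" using Fu_le[of b] ab by (auto intro: order_trans[OF abs_ge_zero])
  have domFu: "dominated \<gamma> Fu"
  proof (rule dominated_le[OF dominated_cmult[OF dominated_powr]])
    show "\<gamma> - 1 \<le> 0" using ga_le by simp
    show "\<bar>Fu t\<bar> \<le> \<bar>normf * X t powr 0\<bar>" if "t \<in> {a<..b}" for t
      using Fu_le[OF that] X_in[OF that] by simp
  qed
  define D where "D = (\<lambda>t. \<bar>ustar t - u t\<bar>)"
  have domD: "dominated \<gamma>' D" unfolding D_def by (intro dominated_abs dominated_diff doms domu)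
  have contD: "continuous_on {a<..b} D" unfolding D_def by (intro continuous_intros conts contu)
  define k where "k = M / (1 - Mstar)"
  have k: "0 < k" using M Mstar by (simp add: k_def)
  have FsFu: "\<bar>Fs t - Fu t\<bar> \<le> k * D t" if "t \<in> {a<..b}" for t
  proof -
    have "\<bar>Fs t - Fu t\<bar> \<le> M * D t + Mstar * \<bar>Fs t - Fu t\<bar>"
      using lip[OF that, of "ustar t" "Fs t" "u t" "Fu t"] Fu_eq[OF that] Fs_eq[OF that] by (simp add: D_def)
    then have "\<bar>Fs t - Fu t\<bar> * (1 - Mstar) \<le> M * D t" by (simp add: algebra_simps)
    then show ?thesis using Mstar by (simp add: k_def pos_le_divide_eq)
  qed
  \<comment> \<open>No bound on \<open>Fs\<close> is assumed. It is obtained from \<open>Fu\<close>,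
    which is bounded by \<open>normf\<close>, and from the Lipschitz estimate of the difference by
    \<open>D\<close>.\<close>
  have "dominated \<gamma>' (\<lambda>t. (Fs t - Fu t) + Fu t)"
  proof (rule dominated_add[OF dominated_le[OF dominated_cmult[OF domD, of k]] dominated_mono[OF domFu ga'_le]])
    show "\<bar>Fs t - Fu t\<bar> \<le> \<bar>k * D t\<bar>" if "t \<in> {a<..b}" for t
      using FsFu[OF that] by (intro order_trans[OF _ abs_ge_self]) auto
  qed
  then have domFs: "dominated \<gamma>' Fs" by simp
  have u_eq: "u t = ua * X t powr (\<gamma> - 1) / Gamma \<gamma> + rl \<alpha> (pull Fu) (X t)" if "t \<in> {a<..b}" for t
  proof -
    obtain C where "\<forall>t\<in>{a<..b}. \<bar>Fu t\<bar> \<le> C * X t powr (\<gamma> - 1)"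
      using domFu unfolding dominated_def by blast
    then show ?thesis
      by (intro hilfer_solution_volterra[OF alpha beta gamma u_sol Fu contFu _ that]) auto
  qed
  have s_eq: "ustar t = ustara * X t powr (\<gamma>' - 1) / Gamma \<gamma>' + rl \<nu> (pull Fs) (X t)" if "t \<in> {a<..b}" for t
  proof -
    obtain C where "\<forall>t\<in>{a<..b}. \<bar>Fs t\<bar> \<le> C * X t powr (\<gamma>' - 1)"
      using domFs unfolding dominated_def by blast
    then show ?thesis
      by (intro hilfer_solution_volterra[OF nu(1,3) beta ga' ustar_sol[folded \<gamma>'_def \<nu>_def] Fs_def contFs _ that]) auto
  qed
  note A' = A[folded \<gamma>'_def \<nu>_def]
  have mFu: "pull Fu \<in> borel_measurable borel" and mD: "pull D \<in> borel_measurable borel"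
    by (rule borel_pull_continuous, fact contFu contD)+
  define c where "c = M * Gamma \<nu> / (Gamma \<alpha> * (1 - Mstar))"
  \<comment> \<open>The Lipschitz argument produces k; the constant c of the claim is larger by the
    factor Gamma \<nu> / Gamma \<alpha>, which is at least 1 since \<nu> < \<alpha> < 1.\<close>
  have kc: "k \<le> c"
  proof -
    have "1 \<le> Gamma \<nu> / Gamma \<alpha>"
      using Gamma_real_antimono[of \<nu> \<alpha>] Gamma_real_pos[of \<alpha>] nu alpha by simp
    then have "k * 1 \<le> k * (Gamma \<nu> / Gamma \<alpha>)" using k by (intro mult_left_mono) auto
    then show ?thesis by (simp add: c_def k_def mult.commute)
  qed
  have D_le: "D t \<le> A t + c * rl \<nu> (pull D) (X t)" if t: "t \<in> {a<..b}" for t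
  proof -
    have exFs: "rl_exists \<nu> (pull Fs) (X t)" and exFu: "rl_exists \<nu> (pull Fu) (X t)" and exD: "rl_exists \<nu> (pull D) (X t)"
      by (rule rl_exists_pull[OF nu(1) ga'_pos _ _ t]; intro domFs contFs domD contD dominated_mono[OF domFu ga'_le] contFu)+
    have range: "\<phi> y \<in> {a<..b}" "y \<in> {0<..L}" if "y \<in> {0<..<X t}" for y
      using \<phi>_in'[of y] that X_in[OF t] by auto
    have 1: "\<bar>rl \<nu> (\<lambda>y. pull Fs y - pull Fu y) (X t)\<bar> \<le> rl \<nu> (\<lambda>y. k * pull D y) (X t)"
      by (rule rl_abs_le[OF nu(1) rl_exists_diff[OF exFs exFu] rl_exists_cmult[OF exD]])
        (use FsFu range in \<open>simp add: pull_def\<close>)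
    have 2: "rl \<nu> (\<lambda>y. pull Fs y - pull Fu y) (X t) = rl \<nu> (pull Fs) (X t) - rl \<nu> (pull Fu) (X t)"
      by (rule rl_diff[OF nu(1) exFs exFu])
    have 3: "\<bar>rl \<nu> (pull Fu) (X t) - rl \<alpha> (pull Fu) (X t)\<bar> \<le>
        normf * \<bar>X t powr \<nu> / Gamma (\<nu> + 1) - X t powr \<nu> / (Gamma \<nu> * Gamma \<alpha>)\<bar>
        + normf * \<bar>X t powr \<nu> / (Gamma \<nu> * Gamma \<alpha>) - X t powr \<alpha> / Gamma (\<alpha> + 1)\<bar>"
      by (rule rl_order_difference[OF _ _ _ _ mFu]) (use nu alpha X_in[OF t] range Fu_le in \<open>simp_all add: pull_def\<close>)
    \<comment> \<open>\<open>A t\<close> is the modulus of the difference of the initial terms plus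
      exactly the right-hand side of 3.\<close>
    have "D t \<le> A t + k * rl \<nu> (pull D) (X t)"
      using 1 3 unfolding 2 rl_cmult D_def u_eq[OF t] s_eq[OF t] A' by linarith
    also have "\<dots> \<le> A t + c * rl \<nu> (pull D) (X t)"
      using kc by (intro add_left_mono mult_right_mono rl_nonneg nu(1)) (auto simp: pull_def D_def)
    finally show ?thesis .
  qed
  have cont_powr: "continuous_on {a<..b} (\<lambda>t. X t powr e)" for e
    using X_in by (intro continuous_intros continuous_on_subset[OF psi_cont sub]) fastforce
  have contA: "continuous_on {a<..b} A"
    by (subst ext[OF A'], unfold divide_inverse)
      (intro continuous_on_add continuous_on_diff continuous_on_mult continuous_on_rabs continuous_on_const cont_powr)
  then have mA[measurable]: "pull A \<in> borel_measurable borel" by (rule borel_pull_continuous)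
  have domA: "dominated \<gamma>' A"
    by (subst ext[OF A'])
      (intro dominated_add dominated_abs dominated_diff dominated_cmult dominated_divide dominated_powr;
        use ga'_le ga_le nu alpha in simp)
  have A0: "0 \<le> A t" for t using normf0 by (simp add: A')
  show ?thesis
  proof
    fix t assume t: "t \<in> {a<..b}"
    let ?K = "\<lambda>y. \<Sum>n. c ^ Suc n * ((X t - y) powr (real (Suc n) * \<nu> - 1) / Gamma (real (Suc n) * \<nu>) * pull A y)"
    obtain C where C: "\<forall>y\<in>{0<..L}. \<bar>pull D y\<bar> \<le> C * y powr (\<gamma>' - 1)"
      using dominated_pull[OF domD] by blast
    obtain C' where C': "\<forall>y\<in>{0<..L}. \<bar>pull A y\<bar> \<le> C' * y powr (\<gamma>' - 1)"
      using dominated_pull[OF domA] by blast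
    have "pull D (X t) \<le> pull A (X t) + (LBINT y:{0<..<X t}. ?K y)"
    proof (rule fractional_gronwall[OF nu(1) ga'_pos _ mD mA])
      show "0 \<le> c" using k kc by simp
      show "pull D y \<le> C * y powr (\<gamma>' - 1)" "pull A y \<le> C' * y powr (\<gamma>' - 1)" if "y \<in> {0<..L}" for y
        using bspec[OF C that] bspec[OF C' that] by auto
      show "pull D y \<le> pull A y + c * rl \<nu> (pull D) y" if "y \<in> {0<..L}" for y
        using D_le[OF \<phi>_in'[OF that]] X_\<phi>[of y] that by (simp add: pull_def)
      show "X t \<in> {0<..L}" by (rule X_in[OF t])
    qed (auto simp: pull_def D_def A0)
    also have "(LBINT y:{0<..<X t}. ?K y) = (LBINT s:{a..t}. (\<Sum>n. let k = Suc n in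
         c ^ k * (d\<psi> s * (\<psi> t - \<psi> s) powr (real k * \<nu> - 1) / Gamma (real k * \<nu>) * A s)))"
    proof (rule substitution(2)[OF t, symmetric])
      show "?K \<in> borel_measurable borel" by measurable
      fix s assume s: "s \<in> {a<..<t}"
      then have z: "0 < X t - X s" using X_mono[of s t] t by simp
      \<comment> \<open>The Jacobian is moved into each term of the series, which converges because
        s < t makes the kernel argument positive.\<close>
      have "d\<psi> s * ?K (X s) = (\<Sum>n. d\<psi> s * (c ^ Suc n * ((X t - X s) powr (real (Suc n) * \<nu> - 1) / Gamma (real (Suc n) * \<nu>) * pull A (X s))))"
        by (rule suminf_mult[OF summable_resolvent_kernel[OF nu(1) z], symmetric])
      then show "(\<Sum>n. let k = Suc n in
         c ^ k * (d\<psi> s * (\<psi> t - \<psi> s) powr (real k * \<nu> - 1) / Gamma (real k * \<nu>) * A s)) = d\<psi> s * ?K (X s)"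
        using s t pull_X[of s A] by (simp add: Let_def mult_ac del: of_nat_Suc power_Suc)
    qed
    finally show "\<bar>ustar t - u t\<bar> \<le> A t +
      (LBINT s:{a..t}. (\<Sum>n. let k = Suc n in
         (M * Gamma (\<alpha> - \<epsilon>) / (Gamma \<alpha> * (1 - Mstar))) ^ k
         * (deriv_on a b \<psi> s * (\<psi> t - \<psi> s) powr (real k * (\<alpha> - \<epsilon>) - 1)
            / Gamma (real k * (\<alpha> - \<epsilon>)) * A s)))"
      using pull_X[OF t, of A] pull_X[OF t, of D] by (simp only: c_def \<nu>_def D_def)
  qed
qed

end
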